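(* Let $A\subset S^1$ be a Borel set that has no translational symmetries, and assume that $$\int_{S^1}\frac{1}{\varphi_A(\varepsilon)}\,d\varepsilon<+\infty .$$ Let $v\in S^1$ be such that the translation $T_v:S^1\to S^1$ is minimal, and let $F_w^n$ be the random iterations associated with $A$ and $v$. Then for Lebesgue-almost any $x,y\in S^1$ and for $\mathbb{P}$-almost every $w\in\Omega$ one has the weak convergence of measures $$\frac1N\sum_{n=1}^N\delta_{F_w^n(x)-F_w^n(y)}\to\overline{\mu}\quad\text{as } N\to\infty,$$ where $\delta_p$ is the Dirac measure at $p$ and the probability measure $\overline{\mu}=\frac1Z\cdot\frac{dx}{\varphi_A(x)}$, $Z=\int_{S^1}\frac{dx}{\varphi_A(x)}$, does not depend on $w$.
   Context: $S^1=\mathbb{T}^1=\mathbb{R}/\mathbb{Z}$ is the circle with normalized Lebesgue (Haar) probability measure $\mathrm{Leb}$; $T_u(x)=x+u$ is the translation by $u\in S^1$. Standing assumption: $v\in S^1$ is such that $v$ and $1$ are linearly independent over $\mathbb{Q}$ (equivalently, $T_v$ is minimal). For a Borel set $A\subset S^1$, its displacement function is $\varphi_A:S^1\to\mathbb{R}$, $\varphi_A(\varepsilon)=\mathrm{Leb}(A\,\triangle\,T_\varepsilon(A))$, where $\triangle$ is the symmetric difference. The set $A$ has no translational symmetries if $\varphi_A(\varepsilon)=0\Leftrightarrow\varepsilon=0$. Given $A$ and $v$, define $f:S^1\to S^1$ by $f(x)=x+v$ if $x\in A$ and $f(x)=x$ if $x\notin A$. For $u\in S^1$ put $f_u=T_u\circ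 f$. Let $\Omega=(S^1)^{\mathbb{N}}$ (sequences $w=(w_1,w_2,\dots)$) with the product probability measure $\mathbb{P}=\mathrm{Leb}^{\mathbb{N}}$. For $w\in\Omega$ set $F_w^n=f_{w_n}\circ\dots\circ f_{w_1}$. *)

theory Defs
  imports "HOL-Probability.Probability"
begin

quotient_type circle = real / "\<lambda>x y. x - y \<in> \<int>"
proof (rule equivpI)
  show "reflp (\<lambda>x y :: real. x - y \<in> \<int>)"
    by (simp add: reflp_def)
  show "symp (\<lambda>x y :: real. x - y \<in> \<int>)"
    by (metis (no_types, lifting) Ints_minus minus_diff_eq sympI)
  show "transp (\<lambda>x y :: real. x - y \<in> \<int>)"
  proof (rule transpI)
    fix x y z :: real
    assume "x - y \<in> \<int>" "y - z \<in> \<int>"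
    then have "(x - y) + (y - z) \<in> \<int>" by (rule Ints_add)
    then show "x - z \<in> \<int>" by simp
  qed
qed

instantiation circle :: ab_group_add
begin

lift_definition zero_circle :: circle is "0 :: real" .

lift_definition plus_circle :: "circle \<Rightarrow> circle \<Rightarrow> circle" is "(+)"
proof -
  fix a b c d :: real
  assume "a - b \<in> \<int>" "c - d \<in> \<int>"
  then have "(a - b) + (c - d) \<in> \<int>" by (rule Ints_add)
  then show "a + c - (b + d) \<in> \<int>" by (simp add: algebra_simps)
qed

lift_definition uminus_circle :: "circle \<Rightarrow> circle" is uminus
proof -
  fix a b :: real
  assume "a - b \<in> \<int>"
  then have "- (a - b) \<in> \<int>" by (rule Ints_minus)
  then show "- a - - b \<in> \<int>" by simp
qed

lift_definition minus_circle :: "circle \<Rightarrow> circle \<Rightarrow> circle" is "(-)"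
proof -
  fix a b c d :: real
  assume "a - b \<in> \<int>" "c - d \<in> \<int>"
  then have "(a - b) - (c - d) \<in> \<int>" by (rule Ints_diff)
  then show "a - c - (b - d) \<in> \<int>" by (simp add: algebra_simps)
qed

instance
  by standard (transfer; simp add: algebra_simps)+

end

text \<open>The topology is the quotient topology of the projection \<^const>\<open>abs_circle\<close>.\<close>

instantiation circle :: topological_space
begin

definition open_circle :: "circle set \<Rightarrow> bool"
  where "open_circle U \<longleftrightarrow> open (abs_circle -` U)"

instance
  by standard (auto simp: open_circle_def vimage_Union)

end

lemma continuous_on_abs_circle: "continuous_on UNIV abs_circle"
  by (simp add: continuous_on_open_vimage open_circle_def)

lemma measurable_abs_circle [measurable]: "abs_circle \<in> borel_measurable borel"
  by (rule borel_measurable_continuous_onI[OF continuous_on_abs_circle])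

definition Leb :: "circle measure"
  where "Leb = distr (restrict_space lborel {0..<1}) borel abs_circle"

lemma measurable_abs_circle_restrict:
  "abs_circle \<in> measurable (restrict_space lborel {0..<1}) borel"
  by (rule measurable_restrict_space1) simp

lemma sets_Leb [simp, measurable_cong]: "sets Leb = sets borel"
  and space_Leb [simp]: "space Leb = UNIV"
  by (simp_all add: Leb_def)

lemma prob_space_Leb: "prob_space Leb"
  unfolding Leb_def
  by (intro prob_space.prob_space_distr measurable_abs_circle_restrict prob_spaceI)
     (simp add: space_restrict_space emeasure_restrict_space)

definition transl :: "circle \<Rightarrow> circle \<Rightarrow> circle"
  where "transl u x = x + u"

definition minimal :: "('a :: topological_space \<Rightarrow> 'a) \<Rightarrow> bool"
  where "minimal h \<longleftrightarrow> (\<forall>x. closure (range (\<lambda>n. (h ^^ n) x)) = UNIV)"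

definition displacement :: "circle set \<Rightarrow> circle \<Rightarrow> real"
  where "displacement A \<epsilon> = measure Leb (sym_diff A (transl \<epsilon> ` A))"

definition no_transl_symmetries :: "circle set \<Rightarrow> bool"
  where "no_transl_symmetries A \<longleftrightarrow> (\<forall>\<epsilon>. displacement A \<epsilon> = 0 \<longleftrightarrow> \<epsilon> = 0)"

text \<open>In \<^typ>\<open>ennreal\<close> one has \<open>1 / 0 = \<infinity>\<close>, so that the integrand below is infinite
  where the displacement vanishes.\<close>

definition Z_const :: "circle set \<Rightarrow> ennreal"
  where "Z_const A = (\<integral>\<^sup>+ \<epsilon>. 1 / ennreal (displacement A \<epsilon>) \<partial>Leb)"

definition mu_bar :: "circle set \<Rightarrow> circle measure"
  where "mu_bar A = density Leb (\<lambda>x. 1 / Z_const A * (1 / ennreal (displacement A x)))"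

definition step :: "circle set \<Rightarrow> circle \<Rightarrow> circle \<Rightarrow> circle"
  where "step A v x = (if x \<in> A then x + v else x)"

definition rand_step :: "circle set \<Rightarrow> circle \<Rightarrow> circle \<Rightarrow> circle \<Rightarrow> circle"
  where "rand_step A v u = transl u \<circ> step A v"

text \<open>Sequences are indexed from \<open>0\<close>, so \<open>w n\<close> is the parameter of the \<open>(n + 1)\<close>-st step.\<close>

primrec rand_iter ::
  "circle set \<Rightarrow> circle \<Rightarrow> (nat \<Rightarrow> circle) \<Rightarrow> nat \<Rightarrow> circle \<Rightarrow> circle"
  where
    "rand_iter A v w 0 = id"
  | "rand_iter A v w (Suc n) = rand_step A v (w n) \<circ> rand_iter A v w n"

definition Prob :: "(nat \<Rightarrow> circle) measure"
  where "Prob = PiM UNIV (\<lambda>_. Leb)"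

definition empirical :: "(nat \<Rightarrow> 'a :: topological_space) \<Rightarrow> nat \<Rightarrow> 'a measure"
  where "empirical p N =
    measure_of UNIV (sets borel) (\<lambda>B. (1 / of_nat N) * (\<Sum>n=1..N. emeasure (return borel (p n)) B))"

lemma sets_empirical [simp, measurable_cong]: "sets (empirical p N) = sets borel"
  and space_empirical [simp]: "space (empirical p N) = UNIV"
  using sets.sigma_sets_eq[of borel] by (simp_all add: empirical_def)

lemma emeasure_empirical:
  assumes "B \<in> sets borel"
  shows "emeasure (empirical p N) B =
    (1 / of_nat N) * (\<Sum>n=1..N. emeasure (return borel (p n)) B)"
proof (rule emeasure_measure_of[OF empirical_def])
  show "sets borel \<subseteq> Pow (UNIV :: 'a set)" by simp
  show "B \<in> sets (empirical p N)" using assms by simp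
  let ?m = "\<lambda>B. (1 / of_nat N) * (\<Sum>n=1..N. emeasure (return borel (p n)) B)"
  show "positive (sets (empirical p N)) ?m"
    by (simp add: positive_def)
  show "countably_additive (sets (empirical p N)) ?m"
  proof (rule countably_additiveI)
    fix E :: "nat \<Rightarrow> 'a set"
    assume E: "range E \<subseteq> sets (empirical p N)" "disjoint_family E"
    have "(\<Sum>i. ?m (E i)) = (1 / of_nat N) * (\<Sum>i. \<Sum>n=1..N. emeasure (return borel (p n)) (E i))"
      by (rule ennreal_suminf_cmult)
    also have "(\<Sum>i. \<Sum>n=1..N. emeasure (return borel (p n)) (E i)) =
        (\<Sum>n=1..N. \<Sum>i. emeasure (return borel (p n)) (E i))"
      by (rule suminf_sum) simp
    also have "\<dots> = (\<Sum>n=1..N. emeasure (return borel (p n)) (\<Union>i. E i))"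
      using E by (intro sum.cong refl suminf_emeasure) auto
    finally show "(\<Sum>i. ?m (E i)) = ?m (\<Union>i. E i)" .
  qed
qed

definition converges_weakly :: "(nat \<Rightarrow> 'a :: topological_space measure) \<Rightarrow> 'a measure \<Rightarrow> bool"
  where "converges_weakly M L \<longleftrightarrow>
    (\<forall>g :: 'a \<Rightarrow> real. continuous_on UNIV g \<and> bounded (range g) \<longrightarrow>
      (\<lambda>N. integral\<^sup>L (M N) g) \<longlonglongrightarrow> integral\<^sup>L L g)"

end

theory Submission
  imports Defs "HOL-Library.Discrete_Functions"
begin

text \<open>
  The difference \<open>D n = F\<^sup>n x - F\<^sup>n y\<close> is a lazy symmetric walk: since the common translation
  re-randomizes the position at each step, from \<open>d\<close> it moves to \<open>d \<plusminus> v\<close> with probability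
  \<open>\<phi> d / 2\<close> each. Hence \<open>Leb \<otimes> d\<epsilon> / \<phi>\<close> is invariant for position and difference, and the
  generator satisfies \<open>h - P h = \<phi> \<cdot> q / 2\<close> with \<open>q x = 2 h x - h (x + v) - h (x - v)\<close>.
  As \<open>T_v\<close> is minimal, every trigonometric polynomial of mean zero is such a second difference
  \<open>q\<close>, and these are dense among the mean zero functions of \<open>L\<^sup>1(Leb)\<close>. Therefore every centred
  continuous observable differs from some \<open>h - P h\<close> by an \<open>L\<^sup>1\<close>-small error. Averages of
  \<open>h - P h\<close> along the walk tend to zero by orthogonality of martingale increments, and the error is
  controlled by the maximal ergodic inequality. Countably many characters suffice for weak
  convergence.
\<close>

section \<open>The circle as a subgroup of the complex plane\<close>

text \<open>Solving \<open>h - P h = g - m\<close> exactly would require a second difference equal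
  to 2 (g - m) / \<phi>. That function is only known to be integrable, and the eigenvalues of the
  second difference come arbitrarily close to 0, so exact solutions are not to be expected. An
  approximate solution suffices because two factors cancel: an L^1(Leb) error r in the second
  difference becomes an error \<phi> r / 2 in the observable, and the invariant density 1 / \<phi>
  turns its norm back into half the L^1(Leb) norm of r, however small \<phi> gets. Hence plain
  L^1(Leb) density is the right notion of approximation.

  The maximal inequality also takes the place of a separate proof of ergodicity: the limit is seen
  to be constant because each observable is, up to small errors, a constant plus some
  \<open>h - P h\<close>. Averages of \<open>h - P h\<close> vanish for every starting pair; only
  the error term costs a null set of starting pairs.\<close>

lift_definition circle_embed :: "circle \<Rightarrow> complex" is "\<lambda>x. cis (2 * pi * x)"
proof -
  fix x y :: real
  assume "x - y \<in> \<int>"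
  then obtain n where "x - y = of_int n" by (elim Ints_cases)
  then have "2 * pi * x = 2 * pi * y + 2 * pi * of_int n"
    by (metis diff_add_cancel distrib_left add.commute)
  then show "cis (2 * pi * x) = cis (2 * pi * y)"
    by (metis Ints_of_int cis_mult cis_multiple_2pi mult_1_right)
qed

lemma circle_embed_add: "circle_embed (x + y) = circle_embed x * circle_embed y"
  by transfer (simp add: cis_mult distrib_left)

lemma circle_embed_uminus: "circle_embed (- x) = cnj (circle_embed x)"
  by transfer (simp add: cis_cnj)

lemma circle_embed_diff: "circle_embed (x - y) = circle_embed x * cnj (circle_embed y)"
  using circle_embed_add[of x "- y"] by (simp add: circle_embed_uminus)

lemma circle_embed_zero [simp]: "circle_embed 0 = 1"
  by transfer simp

lemma norm_circle_embed [simp]: "norm (circle_embed x) = 1"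
  by transfer simp

lemma inj_circle_embed: "inj circle_embed"
proof (rule injI)
  fix x y assume "circle_embed x = circle_embed y"
  then show "x = y"
  proof transfer
    fix x y :: real
    assume "cis (2 * pi * x) = cis (2 * pi * y)"
    then have "sin (2 * pi * x) = sin (2 * pi * y) \<and> cos (2 * pi * x) = cos (2 * pi * y)"
      by (simp add: complex_eq_iff)
    then obtain n :: int where "2 * pi * x = 2 * pi * y + 2 * pi * n"
      by (auto simp: sin_cos_eq_iff)
    then have "2 * pi * (x - y) = 2 * pi * of_int n" by (simp add: algebra_simps)
    then have "x - y = of_int n" by (simp only: mult_cancel_left) simp
    then show "x - y \<in> \<int>" by simp
  qed
qed

lemma continuous_on_circle_embed: "continuous_on S circle_embed"
proof -
  have "open (circle_embed -` B)" if "open B" for B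
  proof -
    have "abs_circle -` (circle_embed -` B) = (\<lambda>x. cis (2 * pi * x)) -` B"
      by (auto simp: circle_embed.abs_eq)
    moreover have "open ((\<lambda>x. cis (2 * pi * x)) -` B)"
      by (intro open_vimage that continuous_intros)
    ultimately show ?thesis by (simp add: open_circle_def)
  qed
  then have "continuous_on UNIV circle_embed"
    by (simp add: continuous_on_open_vimage)
  then show ?thesis by (rule continuous_on_subset) simp
qed

lemma measurable_circle_embed [measurable]: "circle_embed \<in> borel_measurable borel"
  by (rule borel_measurable_continuous_onI[OF continuous_on_circle_embed])

text \<open>The Hausdorff property is pulled back along the continuous injection
  \<open>circle_embed\<close>. It makes the circle an admissible space for the Stone-Weierstrass
  locale \<open>function_ring_on\<close>.\<close>

instance circle :: t2_space
proof
  fix x y :: circle assume "x \<noteq> y"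
  then have "circle_embed x \<noteq> circle_embed y"
    using inj_circle_embed by (auto dest: injD)
  then obtain U V where "open U" "open V" "circle_embed x \<in> U" "circle_embed y \<in> V" "U \<inter> V = {}"
    using hausdorff by metis
  then have "open (circle_embed -` U)" "open (circle_embed -` V)"
    "x \<in> circle_embed -` U" "y \<in> circle_embed -` V" "circle_embed -` U \<inter> circle_embed -` V = {}"
    by (auto intro!: open_vimage continuous_on_circle_embed)
  then show "\<exists>U V. open U \<and> open V \<and> x \<in> U \<and> y \<in> V \<and> U \<inter> V = {}" by blast
qed

lemma abs_circle_frac: "abs_circle (frac t) = abs_circle t"
  by (auto simp: circle.abs_eq_iff frac_def)

lemma range_abs_circle_unit: "abs_circle ` {0..<1} = UNIV"
proof (intro set_eqI iffI UNIV_I)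
  fix x :: circle
  obtain t where "x = abs_circle t"
    using Quotient_abs_rep[OF Quotient_circle] by metis
  then have "x = abs_circle (frac t)" by (simp add: abs_circle_frac)
  then show "x \<in> abs_circle ` {0..<1}" using frac_lt_1[of t] by force
qed

lemma compact_circle: "compact (UNIV :: circle set)"
proof -
  have "compact (abs_circle ` {0..1})"
    by (intro compact_continuous_image continuous_on_subset[OF continuous_on_abs_circle]) auto
  moreover have "abs_circle ` {0..1} = UNIV"
  proof -
    have "abs_circle ` {0..<1} \<subseteq> abs_circle ` {0..1}" by auto
    then show ?thesis unfolding range_abs_circle_unit by blast
  qed
  ultimately show ?thesis by simp
qed

lemma compact_circle_embed_image:
  assumes "closed C" shows "compact (circle_embed ` C)"
  using compact_Int_closed[OF compact_circle assms]
  by (intro compact_continuous_image continuous_on_circle_embed) simp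

text \<open>By compactness and injectivity, an open \<open>U\<close> is the preimage under
  \<open>circle_embed\<close> of the open complement of the compact image of \<open>- U\<close>.
  Measurability of sums and differences on the circle thus reduces to that of complex products and
  conjugates.\<close>

lemma measurable_circleI:
  assumes "(\<lambda>x. circle_embed (f x)) \<in> borel_measurable M"
  shows "f \<in> borel_measurable M"
proof (rule borel_measurableI)
  fix U :: "circle set" assume "open U"
  then have "compact (circle_embed ` (- U))"
    by (intro compact_circle_embed_image) auto
  then have "- circle_embed ` (- U) \<in> sets borel"
    by (intro borel_open open_Compl compact_imp_closed)
  with assms have "(\<lambda>x. circle_embed (f x)) -` (- circle_embed ` (- U)) \<inter> space M \<in> sets M"
    by (rule measurable_sets)
  also have "(\<lambda>x. circle_embed (f x)) -` (- circle_embed ` (- U)) = f -` U"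
    using inj_circle_embed by (auto dest: injD)
  finally show "f -` U \<inter> space M \<in> sets M" .
qed

lemma measurable_cnj [measurable]: "cnj \<in> borel_measurable borel"
  by (intro borel_measurable_continuous_onI continuous_intros)

lemma measurable_circle_add [measurable (raw)]:
  fixes f g :: "'a \<Rightarrow> circle"
  assumes [measurable]: "f \<in> borel_measurable M" "g \<in> borel_measurable M"
  shows "(\<lambda>x. f x + g x) \<in> borel_measurable M"
  by (rule measurable_circleI) (simp add: circle_embed_add)

lemma measurable_circle_diff [measurable (raw)]:
  fixes f g :: "'a \<Rightarrow> circle"
  assumes [measurable]: "f \<in> borel_measurable M" "g \<in> borel_measurable M"
  shows "(\<lambda>x. f x - g x) \<in> borel_measurable M"
  by (rule measurable_circleI) (simp add: circle_embed_diff)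

section \<open>Translation invariance of Lebesgue measure on the circle\<close>

interpretation Leb: prob_space Leb by (rule prob_space_Leb)

lemma nn_integral_Leb:
  assumes [measurable]: "f \<in> borel_measurable borel"
  shows "(\<integral>\<^sup>+ x. f x \<partial>Leb) = (\<integral>\<^sup>+ t\<in>{0..<1}. f (abs_circle t) \<partial>lborel)"
  unfolding Leb_def
  by (simp add: nn_integral_distr measurable_abs_circle_restrict nn_integral_restrict_space)

text \<open>The shifted window from \<open>s\<close> to \<open>1 + s\<close> is cut at 1, and the
  piece beyond 1 is moved back by one period, where it fills the gap from 0 to
  \<open>s\<close>.\<close>

lemma nn_integral_periodic_shift:
  fixes F :: "real \<Rightarrow> ennreal"
  assumes [measurable]: "F \<in> borel_measurable borel"
    and per: "\<And>t. F (t + 1) = F t" and s: "0 \<le> s" "s < 1"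
  shows "(\<integral>\<^sup>+ t\<in>{0..<1}. F (t + s) \<partial>lborel) = (\<integral>\<^sup>+ t\<in>{0..<1}. F t \<partial>lborel)"
proof -
  have per': "F (t - 1) = F t" for t using per[of "t - 1"] by simp
  have "(\<integral>\<^sup>+ t\<in>{0..<1}. F (t + s) \<partial>lborel) = (\<integral>\<^sup>+ t. F t * indicator {s..<1+s} t \<partial>lborel)"
    by (subst (2) nn_integral_real_affine[where c = 1 and t = s])
      (auto intro!: nn_integral_cong simp: indicator_def add.commute)
  also have "\<dots> = (\<integral>\<^sup>+ t. F t * indicator {s..<1} t + F t * indicator {1..<1+s} t \<partial>lborel)"
    using s by (intro nn_integral_cong) (auto simp: indicator_def)
  also have "\<dots> = (\<integral>\<^sup>+ t. F t * indicator {s..<1} t \<partial>lborel) + (\<integral>\<^sup>+ t. F t * indicator {1..<1+s} t \<partial>lborel)"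
    by (rule nn_integral_add) auto
  also have "(\<integral>\<^sup>+ t. F t * indicator {1..<1+s} t \<partial>lborel) = (\<integral>\<^sup>+ t. F t * indicator {0..<s} t \<partial>lborel)"
    by (subst nn_integral_real_affine[where c = 1 and t = 1])
      (auto intro!: nn_integral_cong simp: indicator_def per add.commute)
  also have "(\<integral>\<^sup>+ t. F t * indicator {s..<1} t \<partial>lborel) + \<dots> =
      (\<integral>\<^sup>+ t. F t * indicator {s..<1} t + F t * indicator {0..<s} t \<partial>lborel)"
    by (rule nn_integral_add[symmetric]) auto
  also have "\<dots> = (\<integral>\<^sup>+ t\<in>{0..<1}. F t \<partial>lborel)"
    using s by (intro nn_integral_cong) (auto simp: indicator_def)
  finally show ?thesis .
qed

lemma nn_integral_Leb_transl:
  assumes [measurable]: "f \<in> borel_measurable borel"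
  shows "(\<integral>\<^sup>+ x. f (x + u) \<partial>Leb) = (\<integral>\<^sup>+ x. f x \<partial>Leb)"
proof -
  obtain s where s: "s \<in> {0..<1}" "u = abs_circle s"
    using range_abs_circle_unit by (metis UNIV_I imageE)
  have "abs_circle (t + 1) = abs_circle t" for t by (simp add: circle.abs_eq_iff)
  then show ?thesis
    using nn_integral_periodic_shift[of "\<lambda>t. f (abs_circle t)" s] s
    by (simp add: nn_integral_Leb plus_circle.abs_eq)
qed

lemma distr_Leb_transl: "distr Leb Leb (\<lambda>x. x + u) = Leb"
proof (rule measure_eqI)
  fix B assume "B \<in> sets (distr Leb Leb (\<lambda>x. x + u))"
  then have [measurable]: "B \<in> sets borel" by simp
  have "emeasure (distr Leb Leb (\<lambda>x. x + u)) B = (\<integral>\<^sup>+ x. indicator B x \<partial>distr Leb Leb (\<lambda>x. x + u))"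
    by simp
  also have "\<dots> = (\<integral>\<^sup>+ x. indicator B (x + u) \<partial>Leb)"
    by (rule nn_integral_distr) simp_all
  also have "\<dots> = (\<integral>\<^sup>+ x. indicator B x \<partial>Leb)"
    by (rule nn_integral_Leb_transl) simp
  finally show "emeasure (distr Leb Leb (\<lambda>x. x + u)) B = emeasure Leb B"
    by (simp add: nn_integral_indicator)
qed simp

lemma integral_Leb_transl:
  fixes f :: "circle \<Rightarrow> real"
  assumes [measurable]: "f \<in> borel_measurable borel"
  shows "(\<integral>x. f (x + u) \<partial>Leb) = (\<integral>x. f x \<partial>Leb)"
  using integral_distr[of "\<lambda>x. x + u" Leb Leb f] by (simp add: distr_Leb_transl)

lemma integrable_Leb_transl:
  fixes f :: "circle \<Rightarrow> real"
  assumes "integrable Leb f"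
  shows "integrable Leb (\<lambda>x. f (x + u))"
  using assms integrable_distr[of "\<lambda>x. x + u" Leb Leb f] by (simp add: distr_Leb_transl)

lemma measure_Leb_transl:
  assumes [measurable]: "B \<in> sets borel"
  shows "measure Leb {x. x + u \<in> B} = measure Leb B"
proof -
  have "measure (distr Leb Leb (\<lambda>x. x + u)) B = measure Leb ((\<lambda>x. x + u) -` B \<inter> space Leb)"
    by (rule measure_distr) simp_all
  then show ?thesis by (simp add: distr_Leb_transl vimage_def)
qed

section \<open>The maximal ergodic inequality\<close>

definition birkhoff_sum :: "('a \<Rightarrow> 'a) \<Rightarrow> ('a \<Rightarrow> real) \<Rightarrow> nat \<Rightarrow> 'a \<Rightarrow> real"
  where "birkhoff_sum T f n x = (\<Sum>i<n. f ((T ^^ i) x))"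

text \<open>Unfolded, this is the maximum of the Birkhoff sums of length at most \<open>n\<close>, the empty one
  included.\<close>

primrec max_birkhoff :: "('a \<Rightarrow> 'a) \<Rightarrow> ('a \<Rightarrow> real) \<Rightarrow> nat \<Rightarrow> 'a \<Rightarrow> real"
  where
    "max_birkhoff T f 0 x = 0"
  | "max_birkhoff T f (Suc n) x = max 0 (f x + max_birkhoff T f n (T x))"

lemma birkhoff_sum_Suc: "birkhoff_sum T f (Suc n) x = f x + birkhoff_sum T f n (T x)"
  by (simp add: birkhoff_sum_def sum.lessThan_Suc_shift funpow_swap1 del: sum.lessThan_Suc)

lemma birkhoff_sum_le_max_birkhoff: "n \<le> N \<Longrightarrow> birkhoff_sum T f n x \<le> max_birkhoff T f N x"
proof (induction N arbitrary: n x)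
  case 0 then show ?case by (simp add: birkhoff_sum_def)
next
  case (Suc N)
  show ?case
  proof (cases n)
    case 0 then show ?thesis by (simp add: birkhoff_sum_def)
  next
    case (Suc m)
    with Suc.IH[of m "T x"] Suc.prems show ?thesis by (simp add: birkhoff_sum_Suc)
  qed
qed

lemma max_birkhoff_nonneg: "max_birkhoff T f n x \<ge> 0"
  by (cases n) auto

lemma max_birkhoff_mono: "max_birkhoff T f n x \<le> max_birkhoff T f (Suc n) x"
proof (induction n arbitrary: x)
  case (Suc n)
  show ?case using Suc.IH[of "T x"] by simp
qed simp

lemma measurable_birkhoff_sum:
  assumes [measurable]: "T \<in> measurable M M" "f \<in> borel_measurable M"
  shows "birkhoff_sum T f n \<in> borel_measurable M"
proof -
  have [measurable]: "T ^^ i \<in> measurable M M" for i by (rule measurable_compose_n) simp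
  show ?thesis unfolding birkhoff_sum_def[abs_def] by measurable
qed

lemma integrable_max_birkhoff:
  assumes T: "T \<in> measurable M M" "distr M M T = M" and f: "integrable M f"
  shows "integrable M (max_birkhoff T f n)"
proof (induction n)
  case (Suc n)
  then have "integrable M (\<lambda>x. max_birkhoff T f n (T x))"
    using T integrable_distr[OF T(1), of "max_birkhoff T f n"] by simp
  then have "integrable M (\<lambda>x. max 0 (f x + max_birkhoff T f n (T x)))"
    using f by (intro integrable_max Bochner_Integration.integrable_add) auto
  moreover have "max_birkhoff T f (Suc n) = (\<lambda>x. max 0 (f x + max_birkhoff T f n (T x)))"
    by (rule ext) simp
  ultimately show ?case by (simp only:)
qed (simp add: max_birkhoff.simps(1)[abs_def])

text \<open>Garsia's argument. Where the maximum of order \<open>Suc N\<close> is positive,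
  \<open>f\<close> equals that maximum minus the maximum of order \<open>N\<close> composed with
  \<open>T\<close>; elsewhere this difference is at most 0. Its integral is nonnegative, since
  \<open>T\<close> preserves the measure and the maxima increase with the order.\<close>

lemma maximal_ergodic:
  assumes T: "T \<in> measurable M M" "distr M M T = M" and f: "integrable M f"
  shows "0 \<le> (\<integral>x. f x * indicator {x. max_birkhoff T f n x > 0} x \<partial>M)"
proof (cases n)
  case (Suc N)
  note int = integrable_max_birkhoff[OF T f]
  have meas [measurable]: "max_birkhoff T f m \<in> borel_measurable M" for m
    using int by (rule borel_measurable_integrable)
  have intT: "integrable M (\<lambda>x. max_birkhoff T f m (T x))" for m
    using T integrable_distr[OF T(1), of "max_birkhoff T f m"] int by simp
  have "(\<integral>x. max_birkhoff T f N (T x) \<partial>M) = (\<integral>x. max_birkhoff T f N x \<partial>M)"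
    using T integral_distr[OF T(1), of "max_birkhoff T f N"] meas by simp
  also have "\<dots> \<le> (\<integral>x. max_birkhoff T f (Suc N) x \<partial>M)"
    by (intro integral_mono int max_birkhoff_mono)
  finally have "0 \<le> (\<integral>x. max_birkhoff T f (Suc N) x \<partial>M) - (\<integral>x. max_birkhoff T f N (T x) \<partial>M)"
    by (simp only: diff_ge_0_iff_ge)
  also have "\<dots> = (\<integral>x. max_birkhoff T f (Suc N) x - max_birkhoff T f N (T x) \<partial>M)"
    by (rule Bochner_Integration.integral_diff[OF int intT, symmetric])
  also have "\<dots> \<le> (\<integral>x. f x * indicator {x. max_birkhoff T f n x > 0} x \<partial>M)"
  proof (intro integral_mono Bochner_Integration.integrable_diff int intT)
    have "{x \<in> space M. max_birkhoff T f n x > 0} \<in> sets M" by measurable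
    then have "integrable M (\<lambda>x. f x * indicator {x \<in> space M. max_birkhoff T f n x > 0} x)"
      using f by (rule integrable_real_mult_indicator)
    then show "integrable M (\<lambda>x. f x * indicator {x. max_birkhoff T f n x > 0} x)"
      by (rule Bochner_Integration.integrable_cong[THEN iffD1, rotated -1]) (auto simp: indicator_def)
    show "max_birkhoff T f (Suc N) x - max_birkhoff T f N (T x)
        \<le> f x * indicator {x. max_birkhoff T f n x > 0} x" for x
      using Suc max_birkhoff_nonneg[of T f N "T x"] by (auto simp: indicator_def)
  qed
  finally show ?thesis .
qed simp

text \<open>For \<open>a \<ge> 0\<close> the maximal theorem is applied to \<open>f - a\<close>: a
  Birkhoff sum of \<open>f\<close> above \<open>a * n\<close> is a positive Birkhoff sum of
  \<open>f - a\<close>, so the point lies where the maximum is positive. For negative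
  \<open>a\<close> the left side is at most 0.\<close>

lemma maximal_inequality_upto:
  assumes "finite_measure M" and T: "T \<in> measurable M M" "distr M M T = M"
    and f: "integrable M f" "\<And>x. f x \<ge> 0"
  shows "a * measure M {x \<in> space M. \<exists>n\<le>N. birkhoff_sum T f n x > a * n} \<le> (\<integral>x. f x \<partial>M)"
proof (cases "a \<ge> 0")
  case True
  interpret finite_measure M by fact
  define g where "g = (\<lambda>x. f x - a)"
  have g: "integrable M g" unfolding g_def using f by simp
  note T(1)[measurable]
  have [measurable]: "max_birkhoff T g N \<in> borel_measurable M"
    using integrable_max_birkhoff[OF T g] by (rule borel_measurable_integrable)
  define B where "B = {x \<in> space M. max_birkhoff T g N x > 0}"
  have B [measurable]: "B \<in> sets M" unfolding B_def by measurable
  have "0 \<le> (\<integral>x. g x * indicator {x. max_birkhoff T g N x > 0} x \<partial>M)"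
    by (rule maximal_ergodic[OF T g])
  also have "\<dots> = (\<integral>x. g x * indicator B x \<partial>M)"
    by (intro Bochner_Integration.integral_cong) (auto simp: B_def indicator_def)
  also have "\<dots> = (\<integral>x. f x * indicator B x - a * indicator B x \<partial>M)"
    by (simp add: g_def algebra_simps)
  also have "\<dots> = (\<integral>x. f x * indicator B x \<partial>M) - a * measure M B"
    using f B by (subst Bochner_Integration.integral_diff) (auto intro!: integrable_real_mult_indicator simp: less_top[symmetric])
  also have "(\<integral>x. f x * indicator B x \<partial>M) \<le> (\<integral>x. f x \<partial>M)"
    using f B by (intro integral_mono integrable_real_mult_indicator) (auto simp: indicator_def)
  finally have "a * measure M B \<le> (\<integral>x. f x \<partial>M)" by simp
  moreover have "measure M {x \<in> space M. \<exists>n\<le>N. birkhoff_sum T f n x > a * n} \<le> measure M B"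
  proof (rule finite_measure_mono[OF _ B], safe)
    fix x n assume x: "x \<in> space M" "n \<le> N" "a * n < birkhoff_sum T f n x"
    have "birkhoff_sum T g n x = birkhoff_sum T f n x - a * n"
      by (simp add: birkhoff_sum_def g_def sum_subtractf)
    with x birkhoff_sum_le_max_birkhoff[OF x(2), of T g x] show "x \<in> B" by (simp add: B_def)
  qed
  ultimately show ?thesis using mult_left_mono[OF _ True] by fastforce
next
  case False
  then have "a * measure M {x \<in> space M. \<exists>n\<le>N. birkhoff_sum T f n x > a * n} \<le> 0"
    by (simp add: mult_nonpos_nonneg)
  also have "0 \<le> (\<integral>x. f x \<partial>M)" using f by simp
  finally show ?thesis .
qed

text \<open>Continuity of the measure from below along \<open>N\<close>; the bound does not depend
  on \<open>N\<close>.\<close>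

lemma maximal_inequality:
  assumes fin: "finite_measure M" and T: "T \<in> measurable M M" "distr M M T = M"
    and f: "integrable M f" "\<And>x. f x \<ge> 0"
  shows "a * measure M {x \<in> space M. \<exists>n. birkhoff_sum T f n x > a * n} \<le> (\<integral>x. f x \<partial>M)"
proof -
  interpret finite_measure M by fact
  note T(1)[measurable]
  have [measurable]: "birkhoff_sum T f n \<in> borel_measurable M" for n
    using T f by (intro measurable_birkhoff_sum) auto
  define B where "B N = {x \<in> space M. \<exists>n\<le>N. birkhoff_sum T f n x > a * real n}" for N
  have "(\<lambda>N. measure M (B N)) \<longlonglongrightarrow> measure M (\<Union>N. B N)"
    unfolding B_def
    by (intro finite_Lim_measure_incseq) (auto simp: incseq_def intro: order_trans)
  then have "(\<lambda>N. a * measure M (B N)) \<longlonglongrightarrow> a * measure M (\<Union>N. B N)"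
    by (rule tendsto_mult_left)
  then have "a * measure M (\<Union>N. B N) \<le> (\<integral>x. f x \<partial>M)"
    by (rule LIMSEQ_le_const2)
      (auto simp: B_def intro!: maximal_inequality_upto[OF fin T f])
  also have "(\<Union>N. B N) = {x \<in> space M. \<exists>n. birkhoff_sum T f n x > a * n}"
    by (auto simp: B_def)
  finally show ?thesis .
qed

text \<open>The averages of \<open>c\<close> vanish in the limit, while the maximal inequality
  confines large averages of \<open>r\<close> to a set whose measure is proportional to the norm of
  \<open>r\<close>. The splitting may change with \<open>e\<close>, since each threshold is treated
  separately and the exceptional sets \<open>Bad k\<close> do not mention it.\<close>

lemma birkhoff_average_tendsto_0:
  assumes fin: "finite_measure M" and T: "T \<in> measurable M M" "distr M M T = M"
    and f: "f \<in> borel_measurable M"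
    and approx: "\<And>e. e > 0 \<Longrightarrow> \<exists>c r. (\<forall>x. f x = c x + r x) \<and> integrable M r \<and>
      (\<integral>x. \<bar>r x\<bar> \<partial>M) < e \<and> (AE x in M. (\<lambda>n. birkhoff_sum T c n x / n) \<longlonglongrightarrow> 0)"
  shows "AE x in M. (\<lambda>n. birkhoff_sum T f n x / n) \<longlonglongrightarrow> 0"
proof -
  interpret finite_measure M by fact
  have [measurable]: "birkhoff_sum T f n \<in> borel_measurable M" for n
    using T f by (intro measurable_birkhoff_sum) auto
  define Bad where "Bad k = {x \<in> space M. \<not> (eventually (\<lambda>n. \<bar>birkhoff_sum T f n x / n\<bar> \<le> 2 / Suc k) sequentially)}" for k
  have Bad [measurable]: "Bad k \<in> sets M" for k
    unfolding Bad_def eventually_sequentially by measurable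
  have "measure M (Bad k) = 0" for k
  proof -
    have "measure M (Bad k) \<le> e" if e: "e > 0" for e
    proof -
      \<comment> \<open>Half of the threshold in \<open>Bad k\<close>: one half for the averages of
        \<open>c\<close>, the other for those of \<open>r\<close>. Asking for an error below
        \<open>e * l\<close> makes the maximal inequality at level \<open>l\<close> give a set of
        measure at most \<open>e\<close>.\<close>
      define l where "l = 1 / Suc k"
      have l: "l > 0" by (simp add: l_def)
      obtain c r where fcr: "\<And>x. f x = c x + r x" and r: "integrable M r"
        "(\<integral>x. \<bar>r x\<bar> \<partial>M) < e * l"
        and c: "AE x in M. (\<lambda>n. birkhoff_sum T c n x / n) \<longlonglongrightarrow> 0"
        using approx[of "e * l"] e l by auto
      define B where "B = {x \<in> space M. \<exists>n. birkhoff_sum T (\<lambda>x. \<bar>r x\<bar>) n x > l * n}"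
      have [measurable]: "birkhoff_sum T (\<lambda>x. \<bar>r x\<bar>) n \<in> borel_measurable M" for n
        using T r by (intro measurable_birkhoff_sum) auto
      have B [measurable]: "B \<in> sets M" unfolding B_def by measurable
      have "AE x in M. x \<in> Bad k \<longrightarrow> x \<in> B"
        using c
      proof eventually_elim
        case (elim x)
        show ?case
        proof (intro impI, rule ccontr)
          assume x: "x \<in> Bad k" "x \<notin> B"
          have "eventually (\<lambda>n. \<bar>birkhoff_sum T c n x / n\<bar> < l) sequentially"
            using elim l by (auto dest!: order_tendstoD(2)[OF tendsto_rabs_zero])
          moreover have "eventually (\<lambda>n::nat. n > 0) sequentially" by (rule eventually_gt_at_top)
          ultimately have "eventually (\<lambda>n. \<bar>birkhoff_sum T f n x / n\<bar> \<le> 2 * l) sequentially"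
          proof eventually_elim
            case (elim n)
            have "\<bar>birkhoff_sum T r n x\<bar> \<le> birkhoff_sum T (\<lambda>x. \<bar>r x\<bar>) n x"
              unfolding birkhoff_sum_def by (rule sum_abs)
            also have "\<dots> \<le> l * n"
              using x by (auto simp: B_def Bad_def not_less)
            finally have "\<bar>birkhoff_sum T r n x / n\<bar> \<le> l"
              using elim by (simp add: field_simps)
            moreover have "birkhoff_sum T f n x / n = birkhoff_sum T c n x / n + birkhoff_sum T r n x / n"
              by (simp add: birkhoff_sum_def fcr sum.distrib add_divide_distrib)
            ultimately show ?case using elim by linarith
          qed
          with x show False by (simp add: Bad_def l_def)
        qed
      qed
      then have "measure M (Bad k) \<le> measure M B"
        by (intro finite_measure_mono_AE) auto
      moreover have "l * measure M B \<le> (\<integral>x. \<bar>r x\<bar> \<partial>M)"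
        unfolding B_def using r by (intro maximal_inequality[OF fin T]) auto
      then have "measure M B * l \<le> e * l" using r by (simp add: mult.commute)
      then have "measure M B \<le> e" using l by simp
      ultimately show ?thesis by simp
    qed
    then have "measure M (Bad k) \<le> 0" by (rule field_le_epsilon) simp
    then show ?thesis by (simp add: order_antisym)
  qed
  then have "AE x in M. \<forall>k. x \<notin> Bad k"
    by (auto simp: AE_all_countable emeasure_eq_measure intro!: AE_not_in)
  then show ?thesis
  proof (rule AE_mp, intro AE_I2 impI)
    fix x assume x: "x \<in> space M" "\<forall>k. x \<notin> Bad k"
    show "(\<lambda>n. birkhoff_sum T f n x / n) \<longlonglongrightarrow> 0"
    proof (rule tendstoI)
      fix e :: real assume "e > 0"
      then obtain k where k: "inverse (Suc k) < e / 2"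
        using reals_Archimedean[of "e/2"] by auto
      have "eventually (\<lambda>n. \<bar>birkhoff_sum T f n x / n\<bar> \<le> 2 / Suc k) sequentially"
        using x by (auto simp: Bad_def)
      then show "eventually (\<lambda>n. dist (birkhoff_sum T f n x / n) 0 < e) sequentially"
      proof eventually_elim
        case (elim n)
        have "2 / Suc k < e" using k by (simp add: field_simps)
        with elim show ?case by (simp add: dist_real_def)
      qed
    qed
  qed
qed

section \<open>Trigonometric polynomials and second differences\<close>

text \<open>A complex coefficient inside the real part covers sine and cosine at once. Natural
  exponents suffice, because conjugation turns a negative frequency into a positive one with
  conjugate coefficient.\<close>

inductive_set trig_polys :: "(circle \<Rightarrow> real) set" where
  monom: "(\<lambda>x. Re (c * circle_embed x ^ k)) \<in> trig_polys"
| add: "f \<in> trig_polys \<Longrightarrow> g \<in> trig_polys \<Longrightarrow> (\<lambda>x. f x + g x) \<in> trig_polys"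

lemma trig_polys_const: "(\<lambda>_. c) \<in> trig_polys"
  using trig_polys.monom[of "of_real c" 0] by simp

text \<open>The product formula 2 Re u Re w = Re (u w) + Re (u cnj w), combined with cnj z = 1 / z
  on the unit circle. The order of the exponents keeps \<open>j - k\<close> a genuine difference of
  natural numbers.\<close>

lemma trig_polys_mult_monom_le:
  assumes "k \<le> j"
  shows "(\<lambda>x. Re (a * circle_embed x ^ j) * Re (b * circle_embed x ^ k)) \<in> trig_polys"
proof -
  have eq: "Re (a * circle_embed x ^ j) * Re (b * circle_embed x ^ k) =
    Re (a * b / 2 * circle_embed x ^ (j + k)) + Re (a * cnj b / 2 * circle_embed x ^ (j - k))" for x
  proof -
    define z where "z = circle_embed x"
    have z: "z ^ k * cnj z ^ k = 1"
      unfolding z_def by (simp add: power_mult_distrib[symmetric] complex_norm_square[symmetric])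
    have j: "z ^ j = z ^ (j - k) * z ^ k" using assms by (simp flip: power_add)
    have "(a * z ^ j) * cnj (b * z ^ k) = a * cnj b * z ^ (j - k) * (z ^ k * cnj z ^ k)"
      by (subst j) (simp add: algebra_simps)
    then have "(a * z ^ j) * cnj (b * z ^ k) = a * cnj b * z ^ (j - k)" by (simp add: z)
    moreover have "Re u * Re w = Re (u * w / 2) + Re (u * cnj w / 2)" for u w
      by (simp add: field_simps)
    ultimately show ?thesis by (simp only: z_def[symmetric]) (simp add: power_add algebra_simps)
  qed
  show ?thesis unfolding eq by (intro trig_polys.intros)
qed

lemma trig_polys_mult:
  assumes "f \<in> trig_polys" "g \<in> trig_polys"
  shows "(\<lambda>x. f x * g x) \<in> trig_polys"
  using assms(1)
proof induction
  case (monom a j)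
  show ?case using assms(2)
  proof induction
    case (monom b k)
    show ?case
    proof (cases "k \<le> j")
      case False
      then show ?thesis using trig_polys_mult_monom_le[of j k b a] by (simp only: mult.commute nat_le_linear)
    qed (rule trig_polys_mult_monom_le)
  next
    case (add g1 g2)
    then show ?case using trig_polys.add by (simp only: distrib_left)
  qed
next
  case (add f1 f2)
  then show ?case using trig_polys.add by (simp only: distrib_right)
qed

lemma trig_polys_scale: "f \<in> trig_polys \<Longrightarrow> (\<lambda>x. c * f x) \<in> trig_polys"
  by (rule trig_polys_mult[OF trig_polys_const])

lemma continuous_on_trig_polys: "f \<in> trig_polys \<Longrightarrow> continuous_on UNIV f"
  by (induction rule: trig_polys.induct) (intro continuous_intros continuous_on_circle_embed)+

lemma measurable_trig_polys [measurable_dest]: "f \<in> trig_polys \<Longrightarrow> f \<in> borel_measurable borel"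
  by (rule borel_measurable_continuous_onI[OF continuous_on_trig_polys])

lemma bounded_continuous_circle:
  fixes f :: "circle \<Rightarrow> real"
  assumes "continuous_on UNIV f"
  obtains C where "C > 0" "\<And>x. \<bar>f x\<bar> \<le> C"
proof -
  have "bounded (range f)"
    using compact_continuous_image[OF assms compact_circle] by (rule compact_imp_bounded)
  then show ?thesis using that by (auto simp: bounded_pos)
qed

lemma integrable_continuous_circle:
  fixes f :: "circle \<Rightarrow> real"
  assumes "continuous_on UNIV f"
  shows "integrable Leb f"
proof -
  obtain C where "\<And>x. \<bar>f x\<bar> \<le> C" using bounded_continuous_circle[OF assms] by metis
  moreover have "f \<in> borel_measurable Leb"
    using borel_measurable_continuous_onI[OF assms] by simp
  ultimately show ?thesis by (intro Leb.integrable_const_bound[of _ C]) auto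
qed

lemma trig_polys_integrable: "f \<in> trig_polys \<Longrightarrow> integrable Leb f"
  by (intro integrable_continuous_circle continuous_on_trig_polys)

lemma trig_polys_uniformly_dense:
  assumes "continuous_on UNIV f" "e > 0"
  shows "\<exists>q\<in>trig_polys. \<forall>x. \<bar>f x - q x\<bar> < e"
proof -
  interpret function_ring_on trig_polys UNIV
  proof
    show "compact (UNIV :: circle set)" by (rule compact_circle)
    fix x y :: circle assume "x \<noteq> y"
    then have "circle_embed x \<noteq> circle_embed y"
      using inj_circle_embed by (auto dest: injD)
    \<comment> \<open>The coefficients 1 and \<open>- \<i>\<close> produce the real and the
      imaginary part of \<open>circle_embed\<close>, which together separate points.\<close>
    then have "Re (1 * circle_embed x ^ 1) \<noteq> Re (1 * circle_embed y ^ 1) \<or>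
        Re (- \<i> * circle_embed x ^ 1) \<noteq> Re (- \<i> * circle_embed y ^ 1)"
      by (simp add: complex_eq_iff)
    then show "\<exists>f\<in>trig_polys. f x \<noteq> f y"
      by (elim disjE) (rule bexI, assumption, rule trig_polys.monom)+
  qed (auto intro: continuous_on_trig_polys trig_polys.add trig_polys_mult trig_polys_const)
  show ?thesis using Stone_Weierstrass_basic[OF assms] by auto
qed

section \<open>Density of trigonometric polynomials in L^1\<close>

definition L1_trig_limit :: "(circle \<Rightarrow> real) \<Rightarrow> bool"
  where "L1_trig_limit f \<longleftrightarrow> integrable Leb f \<and>
    (\<forall>e>0. \<exists>q\<in>trig_polys. (\<integral>x. \<bar>f x - q x\<bar> \<partial>Leb) < e)"

lemma L1_trig_limit_closed:
  assumes f: "integrable Leb f"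
    and approx: "\<And>e. e > 0 \<Longrightarrow> \<exists>g. L1_trig_limit g \<and> (\<integral>x. \<bar>f x - g x\<bar> \<partial>Leb) < e"
  shows "L1_trig_limit f"
  unfolding L1_trig_limit_def
proof (intro conjI f allI impI)
  fix e :: real assume "e > 0"
  then obtain g where g: "L1_trig_limit g" "(\<integral>x. \<bar>f x - g x\<bar> \<partial>Leb) < e / 2"
    using approx[of "e / 2"] by auto
  obtain q where q: "q \<in> trig_polys" "(\<integral>x. \<bar>g x - q x\<bar> \<partial>Leb) < e / 2"
    using g(1) \<open>e > 0\<close> unfolding L1_trig_limit_def by (meson half_gt_zero)
  have int: "integrable Leb g" "integrable Leb q"
    using g q trig_polys_integrable by (auto simp: L1_trig_limit_def)
  have "(\<integral>x. \<bar>f x - q x\<bar> \<partial>Leb) \<le> (\<integral>x. \<bar>f x - g x\<bar> + \<bar>g x - q x\<bar> \<partial>Leb)"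
    using f int by (intro integral_mono) auto
  also have "\<dots> = (\<integral>x. \<bar>f x - g x\<bar> \<partial>Leb) + (\<integral>x. \<bar>g x - q x\<bar> \<partial>Leb)"
    using f int by (intro Bochner_Integration.integral_add) auto
  finally show "\<exists>q\<in>trig_polys. (\<integral>x. \<bar>f x - q x\<bar> \<partial>Leb) < e"
    using g q by (intro bexI[of _ q]) auto
qed

lemma L1_trig_limit_continuous:
  assumes "continuous_on UNIV f"
  shows "L1_trig_limit f"
  unfolding L1_trig_limit_def
proof (intro conjI allI impI)
  show int: "integrable Leb f" by (rule integrable_continuous_circle[OF assms])
  fix e :: real assume e: "e > 0"
  then obtain q where q: "q \<in> trig_polys" "\<And>x. \<bar>f x - q x\<bar> < e / 2"
    using trig_polys_uniformly_dense[OF assms, of "e / 2"] by auto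
  have "(\<integral>x. \<bar>f x - q x\<bar> \<partial>Leb) \<le> (\<integral>x. e / 2 \<partial>Leb)"
    using int trig_polys_integrable[OF q(1)] q(2) by (intro integral_mono) (auto intro: less_imp_le)
  also have "\<dots> < e" using e Leb.prob_space by simp
  finally show "\<exists>q\<in>trig_polys. (\<integral>x. \<bar>f x - q x\<bar> \<partial>Leb) < e" using q by blast
qed

lemma L1_trig_limit_add:
  assumes "L1_trig_limit f" "L1_trig_limit g"
  shows "L1_trig_limit (\<lambda>x. f x + g x)"
  unfolding L1_trig_limit_def
proof (intro conjI allI impI)
  have f: "integrable Leb f" and g: "integrable Leb g" using assms by (auto simp: L1_trig_limit_def)
  then show "integrable Leb (\<lambda>x. f x + g x)" by simp
  fix e :: real assume e: "e > 0"
  obtain p where p: "p \<in> trig_polys" "(\<integral>x. \<bar>f x - p x\<bar> \<partial>Leb) < e / 2"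
    using assms(1) e unfolding L1_trig_limit_def by (meson half_gt_zero)
  obtain q where q: "q \<in> trig_polys" "(\<integral>x. \<bar>g x - q x\<bar> \<partial>Leb) < e / 2"
    using assms(2) e unfolding L1_trig_limit_def by (meson half_gt_zero)
  have "(\<integral>x. \<bar>f x + g x - (p x + q x)\<bar> \<partial>Leb) \<le> (\<integral>x. \<bar>f x - p x\<bar> + \<bar>g x - q x\<bar> \<partial>Leb)"
    using f g p q trig_polys_integrable by (intro integral_mono) auto
  also have "\<dots> = (\<integral>x. \<bar>f x - p x\<bar> \<partial>Leb) + (\<integral>x. \<bar>g x - q x\<bar> \<partial>Leb)"
    using f g p q trig_polys_integrable by (intro Bochner_Integration.integral_add) auto
  finally show "\<exists>q\<in>trig_polys. (\<integral>x. \<bar>f x + g x - q x\<bar> \<partial>Leb) < e"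
    using p q trig_polys.add[OF p(1) q(1)] by (intro bexI[of _ "\<lambda>x. p x + q x"]) auto
qed

lemma L1_trig_limit_scale:
  assumes "L1_trig_limit f"
  shows "L1_trig_limit (\<lambda>x. c * f x)"
  unfolding L1_trig_limit_def
proof (intro conjI allI impI)
  have f: "integrable Leb f" using assms by (auto simp: L1_trig_limit_def)
  then show "integrable Leb (\<lambda>x. c * f x)" by simp
  fix e :: real assume e: "e > 0"
  then have "e / (\<bar>c\<bar> + 1) > 0" by simp
  then obtain p where p: "p \<in> trig_polys" "(\<integral>x. \<bar>f x - p x\<bar> \<partial>Leb) < e / (\<bar>c\<bar> + 1)"
    using assms unfolding L1_trig_limit_def by blast
  have "(\<integral>x. \<bar>c * f x - c * p x\<bar> \<partial>Leb) = \<bar>c\<bar> * (\<integral>x. \<bar>f x - p x\<bar> \<partial>Leb)"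
    by (simp flip: right_diff_distrib add: abs_mult)
  also have "\<dots> \<le> (\<bar>c\<bar> + 1) * (\<integral>x. \<bar>f x - p x\<bar> \<partial>Leb)"
    by (intro mult_right_mono) auto
  also have "\<dots> < e" using p(2) by (simp add: pos_less_divide_eq mult.commute)
  finally show "\<exists>q\<in>trig_polys. (\<integral>x. \<bar>c * f x - q x\<bar> \<partial>Leb) < e"
    using trig_polys_scale[OF p(1), of c] by (intro bexI[of _ "\<lambda>x. c * p x"]) auto
qed

text \<open>Dominated convergence turns pointwise limits into L^1 limits. The passages to open sets,
  to disjoint unions and to general integrable functions all go through this one closure
  property.\<close>

lemma L1_trig_limit_dominated:
  assumes s: "\<And>i. L1_trig_limit (s i)" and lim: "\<And>x. (\<lambda>i. s i x) \<longlonglongrightarrow> f x"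
    and dom: "\<And>i x. \<bar>s i x\<bar> \<le> w x" "integrable Leb w"
  shows "L1_trig_limit f"
proof -
  have [measurable]: "s i \<in> borel_measurable Leb" for i
    using s by (auto simp: L1_trig_limit_def)
  then have [measurable]: "f \<in> borel_measurable Leb"
    using lim by (rule borel_measurable_LIMSEQ_real[rotated])
  have fw: "\<bar>f x\<bar> \<le> w x" for x
    using tendsto_rabs[OF lim[of x]] dom(1) by (intro LIMSEQ_le_const2) auto
  have w: "w x \<ge> 0" for x using fw[of x] by linarith
  have f: "integrable Leb f"
    by (rule Bochner_Integration.integrable_bound[OF dom(2)]) (use fw w in auto)
  have "(\<lambda>i. \<integral>x. \<bar>f x - s i x\<bar> \<partial>Leb) \<longlonglongrightarrow> (\<integral>x. 0 \<partial>Leb)"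
  proof (rule integral_dominated_convergence[where w = "\<lambda>x. 2 * w x"])
    show "AE x in Leb. (\<lambda>i. \<bar>f x - s i x\<bar>) \<longlonglongrightarrow> 0"
    proof (rule AE_I2)
      fix x
      have "(\<lambda>i. \<bar>f x - s i x\<bar>) \<longlonglongrightarrow> \<bar>f x - f x\<bar>" by (intro tendsto_intros lim)
      then show "(\<lambda>i. \<bar>f x - s i x\<bar>) \<longlonglongrightarrow> 0" by simp
    qed
    show "AE x in Leb. norm \<bar>f x - s i x\<bar> \<le> 2 * w x" for i
    proof (rule AE_I2)
      fix x show "norm \<bar>f x - s i x\<bar> \<le> 2 * w x" using fw[of x] dom(1)[of i x] by simp
    qed
  qed (use dom in auto)
  then have lim0: "(\<lambda>i. \<integral>x. \<bar>f x - s i x\<bar> \<partial>Leb) \<longlonglongrightarrow> 0" by simp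
  show ?thesis
  proof (rule L1_trig_limit_closed[OF f])
    fix e :: real assume "e > 0"
    with lim0 have "eventually (\<lambda>i. (\<integral>x. \<bar>f x - s i x\<bar> \<partial>Leb) < e) sequentially"
      by (rule order_tendstoD(2))
    then obtain i where "(\<integral>x. \<bar>f x - s i x\<bar> \<partial>Leb) < e"
      by (auto simp: eventually_sequentially)
    then show "\<exists>g. L1_trig_limit g \<and> (\<integral>x. \<bar>f x - g x\<bar> \<partial>Leb) < e" using s by blast
  qed
qed

text \<open>Truncated multiples of the distance to the complement, measured in the plane after
  embedding, are continuous and converge to the indicator from below.\<close>

lemma L1_trig_limit_indicator_open:
  assumes "open U"
  shows "L1_trig_limit (indicator U)"
\<comment> \<open>An empty complement is treated apart because \<open>infdist\<close> to the empty
  set is 0 by convention, which would make every approximant vanish.\<close>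
proof (cases "U = UNIV")
  case True
  then show ?thesis
    using L1_trig_limit_continuous[of "\<lambda>_. 1"] by (simp add: indicator_def[abs_def])
next
  case False
  define C where "C = circle_embed ` (- U)"
  have C: "closed C" "C \<noteq> {}"
    using False assms compact_circle_embed_image[of "- U"]
    by (auto simp: C_def intro: compact_imp_closed)
  have mem: "circle_embed x \<in> C \<longleftrightarrow> x \<notin> U" for x
    using inj_circle_embed by (auto simp: C_def dest: injD)
  define s :: "nat \<Rightarrow> circle \<Rightarrow> real"
    where "s n x = min 1 (real n * infdist (circle_embed x) C)" for n x
  show ?thesis
  proof (rule L1_trig_limit_dominated[where s = s and w = "\<lambda>_. 1"])
    show "L1_trig_limit (s n)" for n unfolding s_def
      by (intro L1_trig_limit_continuous continuous_intros continuous_on_infdist continuous_on_circle_embed)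
    show "\<bar>s n x\<bar> \<le> 1" for n x
      using infdist_nonneg[of "circle_embed x" C] by (simp add: s_def abs_le_iff min_le_iff_disj)
    show "(\<lambda>n. s n x) \<longlonglongrightarrow> indicator U x" for x
    proof (cases "x \<in> U")
      case True
      then have "infdist (circle_embed x) C > 0"
        using C mem[of x] infdist_nonneg[of "circle_embed x" C] in_closed_iff_infdist_zero[of C "circle_embed x"]
        by (auto simp: less_le)
      then obtain N :: nat where N: "1 < N * infdist (circle_embed x) C"
        using reals_Archimedean3 by blast
      have "s n x = 1" if "n \<ge> N" for n
      proof -
        have "real N * infdist (circle_embed x) C \<le> real n * infdist (circle_embed x) C"
          using that by (intro mult_right_mono infdist_nonneg) auto
        with N show ?thesis by (simp add: s_def)
      qed
      then have "eventually (\<lambda>n. s n x = 1) sequentially" by (auto simp: eventually_sequentially)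
      then show ?thesis using True by (simp add: tendsto_eventually)
    next
      case False
      then have "infdist (circle_embed x) C = 0" using mem by simp
      then show ?thesis using False by (simp add: s_def)
    qed
  qed simp
qed

text \<open>Dynkin's argument: open sets are stable under intersection and generate the Borel sets,
  and the property passes to complements and to countable disjoint unions. Disjointness keeps the
  partial sums of indicators bounded by 1.\<close>

lemma L1_trig_limit_indicator:
  assumes "B \<in> sets borel"
  shows "L1_trig_limit (indicator B)"
proof -
  have "Int_stable {S :: circle set. open S}" by (auto simp: Int_stable_def)
  moreover have "{S :: circle set. open S} \<subseteq> Pow UNIV" by simp
  moreover have "B \<in> sigma_sets UNIV {S. open S}" using assms by (simp add: borel_def)
  ultimately show ?thesis
  proof (induction rule: sigma_sets_induct_disjoint[consumes 3, case_names basic empty compl union])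
    case (compl A)
    have "L1_trig_limit (\<lambda>x. 1 + (- 1) * indicator A x)"
      using L1_trig_limit_add[OF L1_trig_limit_continuous[of "\<lambda>_. 1"] L1_trig_limit_scale[OF compl(2), of "-1"]]
      by simp
    also have "(\<lambda>x. 1 + (- 1) * indicator A x) = (indicator (UNIV - A) :: circle \<Rightarrow> real)"
      by (auto simp: indicator_def)
    finally show ?case .
  next
    case (union A)
    show ?case
    proof (rule L1_trig_limit_dominated[where s = "\<lambda>n x. \<Sum>i<n. indicator (A i) x" and w = "\<lambda>_. 1"])
      have zero: "L1_trig_limit (\<lambda>x. 0)" by (intro L1_trig_limit_continuous) simp
      show "L1_trig_limit (\<lambda>x. \<Sum>i<n. indicator (A i) x)" for n
      proof (induction n)
        case (Suc n)
        from L1_trig_limit_add[OF this union(3)[of n]] show ?case by simp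
      qed (simp add: zero)
      have eq: "(\<Sum>i<n. indicator (A i) x) = (indicator (\<Union>i<n. A i) x :: real)" for n x
        using union(1) by (subst indicator_UN_disjoint) (auto simp: disjoint_family_on_def)
      show "\<bar>\<Sum>i<n. indicator (A i) x\<bar> \<le> (1::real)" for n x
        unfolding eq by (auto simp: indicator_def)
      show "(\<lambda>n. \<Sum>i<n. indicator (A i) x) \<longlonglongrightarrow> (indicator (\<Union>i. A i) x :: real)" for x
        unfolding eq by (rule LIMSEQ_indicator_UN)
    qed simp
  next
    case (basic U) then show ?case by (simp add: L1_trig_limit_indicator_open)
  next
    case empty show ?case by (rule L1_trig_limit_indicator_open) simp
  qed
qed

lemma integrable_imp_L1_trig_limit:
  assumes "integrable Leb f"
  shows "L1_trig_limit f"
  using assms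
proof (induction rule: integrable_induct)
  case (base A c)
  then show ?case using L1_trig_limit_scale[OF L1_trig_limit_indicator, of A c] by (simp add: mult.commute)
next
  case (add f g)
  show ?case by (rule L1_trig_limit_add[OF add.IH])
next
  case (lim f s)
  then show ?case
    \<comment> \<open>The dominating function is the one supplied by the limit case of
      \<open>integrable_induct\<close>, whose approximants are bounded by twice the norm of
      \<open>f\<close>.\<close>
    by (auto intro: L1_trig_limit_dominated[of s f "\<lambda>x. 2 * \<bar>f x\<bar>"])
qed

text \<open>Otherwise the orbit of 0 would remain in the closed set of points whose order divides
  \<open>k\<close>, and could not be dense.\<close>

lemma minimal_transl_embed_power_neq_1:
  assumes "minimal (transl v)" "k > 0"
  shows "circle_embed v ^ k \<noteq> 1"
proof
  assume k: "circle_embed v ^ k = 1"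
  define S where "S = {x. circle_embed x ^ k = 1}"
  have "closed S" unfolding S_def
    by (intro closed_Collect_eq continuous_intros continuous_on_circle_embed)
  moreover have "(transl v ^^ n) 0 \<in> S" for n
    using k by (induction n) (auto simp: S_def transl_def circle_embed_add power_mult_distrib)
  ultimately have "closure (range (\<lambda>n. (transl v ^^ n) 0)) \<subseteq> S"
    by (intro closure_minimal) auto
  \<comment> \<open>A point certainly outside \<open>S\<close>: the \<open>k\<close>-th power of its
    image is -1.\<close>
  then have "abs_circle (1 / (2 * k)) \<in> S"
    using assms(1) by (auto simp: minimal_def)
  then have "cis (2 * pi * (1 / (2 * k))) ^ k = 1" by (simp add: S_def circle_embed.abs_eq)
  then show False using assms(2) by (simp add: Complex.DeMoivre)
qed

text \<open>\<open>2 - z^k - z^-k\<close> with \<open>z = circle_embed v\<close> is the eigenvalue of the second difference on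
  the character of order \<open>k\<close>; by minimality it vanishes only for \<open>k = 0\<close>.\<close>

lemma trig_polys_second_difference:
  assumes "minimal (transl v)" "q \<in> trig_polys"
  shows "\<exists>a. \<exists>h\<in>trig_polys. \<forall>x. q x = a + (2 * h x - h (x + v) - h (x - v))"
  using assms(2)
proof induction
  case (monom c k)
  show ?case
  proof (cases "k = 0")
    case True
    then show ?thesis using trig_polys_const[of 0] by (intro exI[of _ "Re c"] bexI[of _ "\<lambda>_. 0"]) auto
  next
    case False
    define z where "z = circle_embed v ^ k"
    have "z \<noteq> 1" using minimal_transl_embed_power_neq_1[OF assms(1)] False by (simp add: z_def)
    moreover have nz: "norm z = 1" by (simp add: z_def norm_power)
    ultimately have "Re z \<noteq> 1"
      using norm_complex_def by (auto simp: complex_eq_iff cmod_def)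
    define h where "h = (\<lambda>x. Re (c / of_real (2 - 2 * Re z) * circle_embed x ^ k))"
    have "Re (c * circle_embed x ^ k) = 0 + (2 * h x - h (x + v) - h (x - v))" for x
    proof -
      define d where "d = c / of_real (2 - 2 * Re z) * circle_embed x ^ k"
      have "2 * h x - h (x + v) - h (x - v) = Re (2 * d - d * z - d * cnj z)"
        by (simp add: h_def d_def z_def circle_embed_add circle_embed_diff power_mult_distrib mult.assoc)
      also have "2 * d - d * z - d * cnj z = d * of_real (2 - 2 * Re z)"
        by (simp add: complex_eq_iff algebra_simps)
      also have "\<dots> = c * circle_embed x ^ k"
        using \<open>Re z \<noteq> 1\<close> by (simp add: d_def del: of_real_diff of_real_mult)
      finally show ?thesis by simp
    qed
    moreover have "h \<in> trig_polys" unfolding h_def by (rule trig_polys.monom)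
    ultimately show ?thesis by blast
  qed
next
  case (add f g)
  then obtain a h b k where "h \<in> trig_polys" "k \<in> trig_polys"
    and "\<And>x. f x = a + (2 * h x - h (x + v) - h (x - v))"
    and "\<And>x. g x = b + (2 * k x - k (x + v) - k (x - v))" by blast
  then show ?case
    by (intro exI[of _ "a + b"] bexI[of _ "\<lambda>x. h x + k x"] trig_polys.add) auto
qed

lemma integral_second_difference:
  assumes "h \<in> trig_polys"
  shows "(\<integral>x. 2 * h x - h (x + v) - h (x - v) \<partial>Leb) = 0"
proof -
  note h = trig_polys_integrable[OF assms] and [measurable] = measurable_trig_polys[OF assms]
  have "(\<integral>x. 2 * h x - h (x + v) - h (x + (- v)) \<partial>Leb) =
      2 * (\<integral>x. h x \<partial>Leb) - (\<integral>x. h (x + v) \<partial>Leb) - (\<integral>x. h (x + (- v)) \<partial>Leb)"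
    using h integrable_Leb_transl[OF h, of v] integrable_Leb_transl[OF h, of "- v"] by simp
  then show ?thesis
    using integral_Leb_transl[of h v] integral_Leb_transl[of h "- v"] by simp
qed

text \<open>A trigonometric polynomial close to \<open>f\<close> is a constant plus a second
  difference. As \<open>f\<close> and all second differences have mean zero, the constant is itself
  bounded by the approximation error, so dropping it at most doubles that error.\<close>

lemma mean_zero_approx_second_difference:
  assumes v: "minimal (transl v)" and f: "integrable Leb f" "(\<integral>x. f x \<partial>Leb) = 0" and e: "e > 0"
  shows "\<exists>h\<in>trig_polys. (\<integral>x. \<bar>f x - (2 * h x - h (x + v) - h (x - v))\<bar> \<partial>Leb) < e"
proof -
  obtain q where q: "q \<in> trig_polys" "(\<integral>x. \<bar>f x - q x\<bar> \<partial>Leb) < e / 2"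
    using integrable_imp_L1_trig_limit[OF f(1)] e unfolding L1_trig_limit_def by (meson half_gt_zero)
  obtain a h where h: "h \<in> trig_polys" and qh: "\<And>x. q x = a + (2 * h x - h (x + v) - h (x - v))"
    using trig_polys_second_difference[OF v q(1)] by blast
  define D where "D = (\<lambda>x. 2 * h x - h (x + v) - h (x - v))"
  note int_h = trig_polys_integrable[OF h]
  have D: "integrable Leb D"
    using int_h integrable_Leb_transl[OF int_h, of v] integrable_Leb_transl[OF int_h, of "- v"]
    by (simp add: D_def)
  have fq: "integrable Leb (\<lambda>x. f x - q x)" using f q trig_polys_integrable by auto
  have qD: "q x = a + D x" for x by (simp add: qh D_def)
  have "(\<integral>x. q x \<partial>Leb) = a + (\<integral>x. D x \<partial>Leb)"
    using D Leb.prob_space by (simp add: qD)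
  also have "(\<integral>x. D x \<partial>Leb) = 0"
    unfolding D_def by (rule integral_second_difference[OF h])
  finally have "(\<integral>x. f x - q x \<partial>Leb) = - a"
    using f trig_polys_integrable[OF q(1)] by simp
  then have a: "\<bar>a\<bar> \<le> (\<integral>x. \<bar>f x - q x\<bar> \<partial>Leb)"
    using integral_abs_bound[of Leb "\<lambda>x. f x - q x"] by simp
  have "(\<integral>x. \<bar>f x - D x\<bar> \<partial>Leb) \<le> (\<integral>x. \<bar>f x - q x\<bar> + \<bar>a\<bar> \<partial>Leb)"
  proof (intro integral_mono)
    show "\<bar>f x - D x\<bar> \<le> \<bar>f x - q x\<bar> + \<bar>a\<bar>" for x unfolding qD by linarith
  qed (use f D fq in auto)
  also have "\<dots> = (\<integral>x. \<bar>f x - q x\<bar> \<partial>Leb) + \<bar>a\<bar>"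
    using fq Leb.prob_space by simp
  also have "\<dots> < e" using a q by simp
  finally show ?thesis using h unfolding D_def by blast
qed

section \<open>A law of large numbers for orthogonal variables\<close>

lemma (in prob_space) orthogonal_second_moment:
  fixes X :: "nat \<Rightarrow> 'a \<Rightarrow> real"
  assumes [measurable]: "\<And>n. X n \<in> borel_measurable M"
    and bound: "\<And>n x. \<bar>X n x\<bar> \<le> C"
    and orth: "\<And>m n. m < n \<Longrightarrow> (\<integral>x. X m x * X n x \<partial>M) = 0"
  shows "integrable M (\<lambda>x. (\<Sum>i<N. X i x)\<^sup>2)" "(\<integral>x. (\<Sum>i<N. X i x)\<^sup>2 \<partial>M) \<le> C\<^sup>2 * N"
proof -
  have C: "C \<ge> 0" using bound[of 0 undefined] by linarith
  have prod: "integrable M (\<lambda>x. X m x * X n x)" for m n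
    by (rule integrable_const_bound[of _ "C * C"])
      (auto simp: abs_mult intro!: mult_mono bound C)
  have eq: "(\<Sum>i<N. X i x)\<^sup>2 = (\<Sum>i<N. \<Sum>j<N. X i x * X j x)" for x
    by (simp add: power2_eq_square sum_product)
  show "integrable M (\<lambda>x. (\<Sum>i<N. X i x)\<^sup>2)"
    unfolding eq by (intro Bochner_Integration.integrable_sum prod)
  have "(\<integral>x. (\<Sum>i<N. X i x)\<^sup>2 \<partial>M) = (\<Sum>i<N. \<Sum>j<N. \<integral>x. X i x * X j x \<partial>M)"
    unfolding eq by (simp add: Bochner_Integration.integral_sum prod)
  also have "\<dots> \<le> (\<Sum>i<N. \<Sum>j<N. if i = j then C\<^sup>2 else 0)"
  proof (intro sum_mono)
    fix i j
    have "(\<integral>x. X i x * X j x \<partial>M) = 0" if "i \<noteq> j"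
      using orth[of i j] orth[of j i] that by (cases "i < j") (auto simp: mult.commute)
    moreover have "(\<integral>x. X i x * X i x \<partial>M) \<le> (\<integral>x. C\<^sup>2 \<partial>M)"
    proof (intro integral_mono prod)
      fix x
      have "\<bar>X i x\<bar> * \<bar>X i x\<bar> \<le> C * C" by (intro mult_mono bound C) simp
      then show "X i x * X i x \<le> C\<^sup>2" by (simp add: power2_eq_square)
    qed simp
    ultimately show "(\<integral>x. X i x * X j x \<partial>M) \<le> (if i = j then C\<^sup>2 else 0)"
      using prob_space by auto
  qed
  also have "\<dots> = C\<^sup>2 * N" by simp
  finally show "(\<integral>x. (\<Sum>i<N. X i x)\<^sup>2 \<partial>M) \<le> C\<^sup>2 * N" .
qed

text \<open>Between consecutive squares \<open>k\<^sup>2\<close> and \<open>(k + 1)\<^sup>2\<close>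
  at most \<open>2 * k\<close> further terms occur, each bounded by \<open>C\<close>; they are
  negligible after division by \<open>k\<^sup>2\<close>.\<close>

lemma average_tendsto_0_along_squares:
  fixes a :: "nat \<Rightarrow> real"
  assumes bound: "\<And>n. \<bar>a n\<bar> \<le> C"
    and sq: "(\<lambda>k. (\<Sum>i<k\<^sup>2. a i) / real (k\<^sup>2)) \<longlonglongrightarrow> 0"
  shows "(\<lambda>n. (\<Sum>i<n. a i) / n) \<longlonglongrightarrow> 0"
proof (rule Lim_null_comparison)
  have lim: "filterlim floor_sqrt at_top sequentially"
    unfolding filterlim_at_top
  proof
    fix Z :: nat
    show "eventually (\<lambda>n. Z \<le> floor_sqrt n) sequentially"
      using eventually_ge_at_top[of "Z\<^sup>2"]
      by eventually_elim (simp add: le_floor_sqrt_iff)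
  qed
  have "(\<lambda>k::nat. 2 * C / real k) \<longlonglongrightarrow> 0" by (rule lim_const_over_n)
  with tendsto_rabs_zero[OF sq]
  have "(\<lambda>k. \<bar>(\<Sum>i<k\<^sup>2. a i) / real (k\<^sup>2)\<bar> + 2 * C / k) \<longlonglongrightarrow> 0"
    by (rule tendsto_add_zero)
  from filterlim_compose[OF this lim]
  show "(\<lambda>n. \<bar>(\<Sum>i<(floor_sqrt n)\<^sup>2. a i) / real ((floor_sqrt n)\<^sup>2)\<bar> + 2 * C / floor_sqrt n) \<longlonglongrightarrow> 0" .
  show "eventually (\<lambda>n. norm ((\<Sum>i<n. a i) / n) \<le>
      \<bar>(\<Sum>i<(floor_sqrt n)\<^sup>2. a i) / real ((floor_sqrt n)\<^sup>2)\<bar> + 2 * C / floor_sqrt n) sequentially"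
    using eventually_gt_at_top[of 0]
  proof eventually_elim
    case (elim n)
    define k where "k = floor_sqrt n"
    have k: "k\<^sup>2 \<le> n" "n < (Suc k)\<^sup>2" "k > 0"
      using elim by (auto simp: k_def Suc_floor_sqrt_power2_gt)
    have C: "C \<ge> 0" using bound[of 0] by linarith
    have "(\<Sum>i<n. a i) = (\<Sum>i<k\<^sup>2. a i) + (\<Sum>i\<in>{k\<^sup>2..<n}. a i)"
      using sum.atLeastLessThan_concat[of 0 "k\<^sup>2" n a] k(1) by (simp add: lessThan_atLeast0)
    moreover have "\<bar>\<Sum>i\<in>{k\<^sup>2..<n}. a i\<bar> \<le> 2 * C * k"
    proof -
      have "\<bar>\<Sum>i\<in>{k\<^sup>2..<n}. a i\<bar> \<le> (\<Sum>i\<in>{k\<^sup>2..<n}. \<bar>a i\<bar>)" by (rule sum_abs)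
      also have "\<dots> \<le> (\<Sum>i\<in>{k\<^sup>2..<n}. C)" by (intro sum_mono bound)
      also have "\<dots> = real (n - k\<^sup>2) * C" by simp
      also have "\<dots> \<le> real (2 * k) * C"
        using k by (intro mult_right_mono C of_nat_mono) (simp add: power2_eq_square)
      finally show ?thesis by (simp add: algebra_simps)
    qed
    ultimately have "\<bar>\<Sum>i<n. a i\<bar> \<le> \<bar>\<Sum>i<k\<^sup>2. a i\<bar> + 2 * C * k" by linarith
    then have "\<bar>\<Sum>i<n. a i\<bar> / n \<le> (\<bar>\<Sum>i<k\<^sup>2. a i\<bar> + 2 * C * k) / n"
      by (rule divide_right_mono) simp
    also have "\<dots> \<le> (\<bar>\<Sum>i<k\<^sup>2. a i\<bar> + 2 * C * k) / real (k\<^sup>2)"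
      using k C elim by (intro divide_left_mono mult_pos_pos of_nat_mono) auto
    also have "\<dots> = \<bar>(\<Sum>i<k\<^sup>2. a i) / real (k\<^sup>2)\<bar> + 2 * C / k"
      using k by (simp add: add_divide_distrib power2_eq_square)
    finally show ?case unfolding k_def[symmetric] by simp
  qed
qed

text \<open>Along squares the second moments of the averages are at most
  \<open>C\<^sup>2 / k\<^sup>2\<close>, hence summable. So the squared averages have an almost
  surely finite sum and tend to 0; boundedness fills the gaps between squares.\<close>

lemma (in prob_space) orthogonal_bounded_LLN:
  fixes X :: "nat \<Rightarrow> 'a \<Rightarrow> real"
  assumes [measurable]: "\<And>n. X n \<in> borel_measurable M"
    and bound: "\<And>n x. \<bar>X n x\<bar> \<le> C"
    and orth: "\<And>m n. m < n \<Longrightarrow> (\<integral>x. X m x * X n x \<partial>M) = 0"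
  shows "AE x in M. (\<lambda>n. (\<Sum>i<n. X i x) / n) \<longlonglongrightarrow> 0"
proof -
  \<comment> \<open>The term with \<open>k = 0\<close> is 0, as division by zero yields 0; the bound
    \<open>C\<^sup>2 / k\<^sup>2\<close> is read in the same way.\<close>
  define s where "s k x = ((\<Sum>i<k\<^sup>2. X i x) / real (k\<^sup>2))\<^sup>2" for k x
  have s_nonneg: "s k x \<ge> 0" for k x by (simp add: s_def)
  have [measurable]: "s k \<in> borel_measurable M" for k unfolding s_def by measurable
  have "summable (\<lambda>k. C\<^sup>2 * (1 / real k ^ 2))"
    using inverse_power_summable[of 2, where 'a = real]
    by (intro summable_mult) (simp add: inverse_eq_divide)
  then have sum: "summable (\<lambda>k. C\<^sup>2 / real (k\<^sup>2))" by simp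
  have "(\<integral>\<^sup>+x. (\<Sum>k. ennreal (s k x)) \<partial>M) = (\<Sum>k. \<integral>\<^sup>+x. ennreal (s k x) \<partial>M)"
    by (rule nn_integral_suminf) simp
  also have "\<dots> \<le> (\<Sum>k. ennreal (C\<^sup>2 / real (k\<^sup>2)))"
  proof (intro suminf_le allI)
    fix k
    note m = orthogonal_second_moment[where X = X and N = "k\<^sup>2", OF assms]
    have s: "s k x = (\<Sum>i<k\<^sup>2. X i x)\<^sup>2 / (real (k\<^sup>2))\<^sup>2" for x
      by (simp add: s_def power_divide)
    have "integrable M (s k)" unfolding s using m(1) by (rule integrable_divide)
    then have "(\<integral>\<^sup>+x. ennreal (s k x) \<partial>M) = ennreal (\<integral>x. s k x \<partial>M)"
      by (intro nn_integral_eq_integral) (auto simp: s_nonneg)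
    also have "(\<integral>x. s k x \<partial>M) = (\<integral>x. (\<Sum>i<k\<^sup>2. X i x)\<^sup>2 \<partial>M) / (real (k\<^sup>2))\<^sup>2"
      unfolding s by simp
    also have "\<dots> \<le> C\<^sup>2 * real (k\<^sup>2) / (real (k\<^sup>2))\<^sup>2"
      using m(2) by (intro divide_right_mono) auto
    also have "\<dots> = C\<^sup>2 / real (k\<^sup>2)" by (simp add: power2_eq_square)
    finally show "(\<integral>\<^sup>+x. ennreal (s k x) \<partial>M) \<le> ennreal (C\<^sup>2 / real (k\<^sup>2))"
      by (simp add: ennreal_leI)
  qed auto
  also have "\<dots> = ennreal (\<Sum>k. C\<^sup>2 / real (k\<^sup>2))"
    using sum by (intro suminf_ennreal2) auto
  finally have "(\<integral>\<^sup>+x. (\<Sum>k. ennreal (s k x)) \<partial>M) < \<infinity>"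
    by (rule le_less_trans) simp
  then have "AE x in M. (\<Sum>k. ennreal (s k x)) \<noteq> \<infinity>"
    by (intro nn_integral_PInf_AE) auto
  then show ?thesis
  proof eventually_elim
    case (elim x)
    have "summable (\<lambda>k. s k x)"
      using elim by (intro summable_suminf_not_top) (auto simp: s_nonneg)
    then have "(\<lambda>k. s k x) \<longlonglongrightarrow> 0" by (rule summable_LIMSEQ_zero)
    then have "(\<lambda>k. sqrt (s k x)) \<longlonglongrightarrow> sqrt 0" by (rule tendsto_real_sqrt)
    then have "(\<lambda>k. (\<Sum>i<k\<^sup>2. X i x) / real (k\<^sup>2)) \<longlonglongrightarrow> 0"
      unfolding s_def real_sqrt_abs real_sqrt_zero tendsto_rabs_zero_iff .
    then show ?case by (rule average_tendsto_0_along_squares[OF bound])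
  qed
qed

section \<open>The walk of differences and its invariant measure\<close>

locale displacement_walk =
  fixes A :: "circle set" and v :: circle
  assumes A [measurable]: "A \<in> sets borel"
    and finite_Z: "(\<integral>\<^sup>+ \<epsilon>. 1 / ennreal (displacement A \<epsilon>) \<partial>Leb) < \<infinity>"
    and minimal_v: "minimal (transl v)"
begin

text \<open>This form reads the displacement as the probability that exactly one of the points
  \<open>t + d\<close> and \<open>t\<close>, with \<open>t\<close> uniform, lies in
  \<open>A\<close>, that is, that \<open>step\<close> moves only one of them.\<close>

lemma displacement_eq: "displacement A d = measure Leb {t. (t + d \<in> A) \<noteq> (t \<in> A)}"
proof -
  have "displacement A d = measure Leb {x. (x \<in> A) \<noteq> (x - d \<in> A)}"
    unfolding displacement_def transl_def
  proof (rule arg_cong[where f = "measure Leb"])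
    have "(\<lambda>x. x + d) ` A = {x. x - d \<in> A}" by (force simp: image_iff)
    then show "sym_diff A ((\<lambda>x. x + d) ` A) = {x. (x \<in> A) \<noteq> (x - d \<in> A)}" by auto
  qed
  also have "\<dots> = measure Leb {t. t + d \<in> {x. (x \<in> A) \<noteq> (x - d \<in> A)}}"
    by (rule measure_Leb_transl[symmetric]) measurable
  finally show ?thesis by simp
qed

lemma displacement_nonneg: "displacement A d \<ge> 0"
  by (simp add: displacement_def)

lemma displacement_le_1: "displacement A d \<le> 1"
  by (simp add: displacement_def Leb.prob_le_1)

text \<open>The displacement at \<open>d\<close> is the measure of a section of a measurable subset
  of the product, so parametrized integration gives measurability.\<close>

lemma measurable_displacement [measurable]: "displacement A \<in> borel_measurable borel"
proof -
  define S where "S = {z. (snd z + fst z \<in> A) \<noteq> (snd z \<in> A)}"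
  have "{z \<in> space (borel \<Otimes>\<^sub>M Leb). (snd z + fst z \<in> A) \<noteq> (snd z \<in> A)} \<in> sets (borel \<Otimes>\<^sub>M Leb)"
    by measurable
  then have [measurable]: "S \<in> sets (borel \<Otimes>\<^sub>M Leb)"
    by (simp add: S_def space_pair_measure)
  have "displacement A d = (\<integral>t. indicat_real S (d, t) \<partial>Leb)" for d
  proof -
    have "displacement A d = (\<integral>t. indicat_real {t. (t + d \<in> A) \<noteq> (t \<in> A)} t \<partial>Leb)"
      by (simp add: displacement_eq)
    also have "\<dots> = (\<integral>t. indicat_real S (d, t) \<partial>Leb)"
      by (intro Bochner_Integration.integral_cong) (auto simp: indicator_def S_def)
    finally show ?thesis .
  qed
  then have "displacement A = (\<lambda>d. \<integral>t. indicat_real S (d, t) \<partial>Leb)" by auto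
  also have "\<dots> \<in> borel_measurable borel"
    by (rule Leb.borel_measurable_lebesgue_integral) (simp add: case_prod_unfold)
  finally show ?thesis .
qed

abbreviation up :: "circle \<Rightarrow> circle set" where "up d \<equiv> {t. t + d \<in> A \<and> t \<notin> A}"
abbreviation down :: "circle \<Rightarrow> circle set" where "down d \<equiv> {t. t + d \<notin> A \<and> t \<in> A}"

text \<open>The set of \<open>t\<close> with \<open>t + d \<in> A\<close> and the set
  \<open>A\<close> itself have equal measure. Removing their common part leaves \<open>up d\<close>
  and \<open>down d\<close>, which therefore share the displacement equally: this is the symmetry of
  the walk.\<close>

lemma measure_up: "measure Leb (up d) = displacement A d / 2"
  and measure_down: "measure Leb (down d) = displacement A d / 2"
  and measure_stay: "measure Leb (- (up d \<union> down d)) = 1 - displacement A d"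
proof -
  have [measurable]: "up d \<in> sets borel" "down d \<in> sets borel" by measurable
  have both [measurable]: "{t. t + d \<in> A \<and> t \<in> A} \<in> sets borel" by measurable
  have "{t. t + d \<in> A} = up d \<union> {t. t + d \<in> A \<and> t \<in> A}" by auto
  then have "measure Leb {t. t + d \<in> A} = measure Leb (up d) + measure Leb {t. t + d \<in> A \<and> t \<in> A}"
    by (simp only:) (rule Leb.finite_measure_Union, auto)
  moreover have "A = down d \<union> {t. t + d \<in> A \<and> t \<in> A}" by auto
  then have "measure Leb A = measure Leb (down d) + measure Leb {t. t + d \<in> A \<and> t \<in> A}"
    using Leb.finite_measure_Union[of "down d" "{t. t + d \<in> A \<and> t \<in> A}"] by auto
  ultimately have eq: "measure Leb (up d) = measure Leb (down d)"
    using measure_Leb_transl[OF A, of d] by simp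
  have "{t. (t + d \<in> A) \<noteq> (t \<in> A)} = up d \<union> down d" by auto
  then have sum: "displacement A d = measure Leb (up d \<union> down d)" by (simp add: displacement_eq)
  also have "\<dots> = measure Leb (up d) + measure Leb (down d)"
    by (rule Leb.finite_measure_Union) auto
  finally show "measure Leb (up d) = displacement A d / 2" "measure Leb (down d) = displacement A d / 2"
    using eq by auto
  have "measure Leb (UNIV - (up d \<union> down d)) = 1 - measure Leb (up d \<union> down d)"
    using Leb.prob_compl[of "up d \<union> down d"] by simp
  then show "measure Leb (- (up d \<union> down d)) = 1 - displacement A d"
    using sum by (simp add: Compl_eq_Diff_UNIV)
qed

lemma step_diff: "step A v (t + d) - step A v t =
    (if t \<in> up d then d + v else if t \<in> down d then d - v else d)"
  by (auto simp: step_def algebra_simps)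

lemma nn_integral_step_diff:
  shows "(\<integral>\<^sup>+ t. F (step A v (t + d) - step A v t) \<partial>Leb) =
    F d * ennreal (1 - displacement A d) + F (d + v) * ennreal (displacement A d / 2)
      + F (d - v) * ennreal (displacement A d / 2)"
proof -
  have [measurable]: "up d \<in> sets borel" "down d \<in> sets borel" by measurable
  have "(\<integral>\<^sup>+ t. F (step A v (t + d) - step A v t) \<partial>Leb) =
      (\<integral>\<^sup>+ t. F d * indicator (- (up d \<union> down d)) t + F (d + v) * indicator (up d) t
        + F (d - v) * indicator (down d) t \<partial>Leb)"
    unfolding step_diff by (intro nn_integral_cong) (auto simp: indicator_def)
  also have "\<dots> = F d * emeasure Leb (- (up d \<union> down d)) + F (d + v) * emeasure Leb (up d)
      + F (d - v) * emeasure Leb (down d)"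
    by (simp add: nn_integral_add nn_integral_cmult_indicator)
  finally show ?thesis
    unfolding Leb.emeasure_eq_measure measure_up measure_down measure_stay .
qed

lemma integral_step_diff:
  fixes h :: "circle \<Rightarrow> real"
  shows "(\<integral>t. h (step A v (t + d) - step A v t) \<partial>Leb) =
    h d - displacement A d * (2 * h d - h (d + v) - h (d - v)) / 2"
proof -
  have [measurable]: "up d \<in> sets borel" "down d \<in> sets borel" by measurable
  have "(\<integral>t. h (step A v (t + d) - step A v t) \<partial>Leb) =
      (\<integral>t. h d * indicator (- (up d \<union> down d)) t + h (d + v) * indicator (up d) t
        + h (d - v) * indicator (down d) t \<partial>Leb)"
    unfolding step_diff by (intro Bochner_Integration.integral_cong) (auto simp: indicator_def)
  also have "\<dots> = h d * measure Leb (- (up d \<union> down d)) + h (d + v) * measure Leb (up d)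
      + h (d - v) * measure Leb (down d)"
    by (simp add: less_top[symmetric])
  finally show ?thesis
    unfolding measure_up measure_down measure_stay by (simp add: field_simps)
qed

section \<open>The invariant measure for the pair of points\<close>

definition weight :: "circle \<Rightarrow> ennreal"
  where "weight d = 1 / ennreal (displacement A d)"

lemma measurable_weight [measurable]: "weight \<in> borel_measurable borel"
  unfolding weight_def by measurable

lemma AE_displacement_pos: "AE d in Leb. displacement A d > 0"
proof -
  have "AE d in Leb. weight d \<noteq> \<infinity>"
    using finite_Z by (intro nn_integral_PInf_AE) (auto simp: weight_def)
  then show ?thesis
  proof eventually_elim
    case (elim d)
    then have "displacement A d \<noteq> 0" by (auto simp: weight_def divide_ennreal_def)
    then show ?case using displacement_nonneg[of d] by simp
  qed
qed

lemma weight_pos_eq: "displacement A d > 0 \<Longrightarrow> weight d = ennreal (1 / displacement A d)"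
  by (simp add: weight_def divide_ennreal flip: ennreal_1)

text \<open>Positivity at every point is what later transfers almost-everywhere statements from the
  weighted measure back to \<open>Leb \<Otimes>\<^sub>M Leb\<close>.\<close>

lemma weight_pos: "weight d > 0"
  by (simp add: weight_def ennreal_zero_less_divide)

text \<open>The weight turns the jump probability \<phi> / 2 into the constant 1/2, so by
  translation invariance the two jumps together contribute the plain integral of \<open>F\<close>.
  This replaces exactly what was lost by not staying, since (1 - \<phi>) / \<phi> + 1 = 1 /
  \<phi>.\<close>

lemma nn_integral_weight_step_diff:
  assumes [measurable]: "F \<in> borel_measurable borel"
  shows "(\<integral>\<^sup>+ d. weight d * (\<integral>\<^sup>+ t. F (step A v (t + d) - step A v t) \<partial>Leb) \<partial>Leb) =
    (\<integral>\<^sup>+ d. weight d * F d \<partial>Leb)"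
proof -
  have "(\<integral>\<^sup>+ d. weight d * (\<integral>\<^sup>+ t. F (step A v (t + d) - step A v t) \<partial>Leb) \<partial>Leb) =
      (\<integral>\<^sup>+ d. F d * (weight d * ennreal (1 - displacement A d))
        + (F (d + v) * ennreal (1/2) + F (d + (- v)) * ennreal (1/2)) \<partial>Leb)"
    unfolding nn_integral_step_diff
  proof (intro nn_integral_cong_AE)
    show "AE d in Leb. weight d * (F d * ennreal (1 - displacement A d) + F (d + v) * ennreal (displacement A d / 2)
        + F (d - v) * ennreal (displacement A d / 2)) = F d * (weight d * ennreal (1 - displacement A d))
        + (F (d + v) * ennreal (1/2) + F (d + (- v)) * ennreal (1/2))"
      using AE_displacement_pos
    proof eventually_elim
      case (elim d)
      then have "weight d * ennreal (displacement A d / 2) = ennreal (1/2)"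
        by (simp add: weight_pos_eq flip: ennreal_mult)
      then have eq: "weight d * (x * ennreal (displacement A d / 2)) = x * ennreal (1/2)" for x
        by (metis mult.left_commute)
      show ?case
        by (simp only: distrib_left eq add.assoc mult.left_commute[of "weight d" "F d"] diff_conv_add_uminus)
    qed
  qed
  also have "\<dots> = (\<integral>\<^sup>+ d. F d * (weight d * ennreal (1 - displacement A d)) \<partial>Leb)
      + ((\<integral>\<^sup>+ d. F (d + v) \<partial>Leb) * ennreal (1/2) + (\<integral>\<^sup>+ d. F (d + (- v)) \<partial>Leb) * ennreal (1/2))"
    by (simp add: nn_integral_add nn_integral_multc)
  also have "\<dots> = (\<integral>\<^sup>+ d. F d * (weight d * ennreal (1 - displacement A d)) \<partial>Leb)
      + (\<integral>\<^sup>+ d. F d \<partial>Leb) * (ennreal (1/2) + ennreal (1/2))"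
    by (simp only: nn_integral_Leb_transl[OF assms] distrib_left)
  also have "ennreal (1/2) + ennreal (1/2) = 1" by (subst ennreal_plus[symmetric]) simp_all
  also have "(\<integral>\<^sup>+ d. F d * (weight d * ennreal (1 - displacement A d)) \<partial>Leb) + (\<integral>\<^sup>+ d. F d \<partial>Leb) * 1 =
      (\<integral>\<^sup>+ d. F d * (weight d * ennreal (1 - displacement A d)) + F d \<partial>Leb)"
    by (simp add: nn_integral_add)
  also have "\<dots> = (\<integral>\<^sup>+ d. weight d * F d \<partial>Leb)"
  proof (intro nn_integral_cong_AE)
    show "AE d in Leb. F d * (weight d * ennreal (1 - displacement A d)) + F d = weight d * F d"
      using AE_displacement_pos
    proof eventually_elim
      case (elim d)
      have "weight d * ennreal (1 - displacement A d) + 1 = weight d"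
        using elim displacement_le_1[of d]
        by (simp add: weight_pos_eq field_simps flip: ennreal_mult ennreal_1 ennreal_plus)
      then have "F d * (weight d * ennreal (1 - displacement A d) + 1) = F d * weight d" by simp
      then show ?case by (simp add: distrib_left mult.commute)
    qed
  qed
  finally show ?thesis .
qed

text \<open>The measure lives on pairs of points because the random maps act on points. In the
  coordinates (d, t) of the pair (t + d, t) it is a product, with \<open>t\<close> uniform; its
  total mass is Z, not 1.\<close>

definition pair_measure_weighted :: "(circle \<times> circle) measure"
  where "pair_measure_weighted = density (Leb \<Otimes>\<^sub>M Leb) (\<lambda>z. weight (fst z - snd z))"

lemma sets_pair_measure_weighted [measurable_cong]:
  "sets pair_measure_weighted = sets (borel \<Otimes>\<^sub>M borel)"
  by (simp add: pair_measure_weighted_def cong: sets_pair_measure_cong)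

lemma nn_integral_Leb_pair:
  assumes [measurable]: "F \<in> borel_measurable (borel \<Otimes>\<^sub>M borel)"
  shows "(\<integral>\<^sup>+ z. F z \<partial>(Leb \<Otimes>\<^sub>M Leb)) = (\<integral>\<^sup>+ d. \<integral>\<^sup>+ t. F (t + d, t) \<partial>Leb \<partial>Leb)"
proof -
  interpret pair_sigma_finite Leb Leb ..
  have "(\<integral>\<^sup>+ z. F z \<partial>(Leb \<Otimes>\<^sub>M Leb)) = (\<integral>\<^sup>+ t. \<integral>\<^sup>+ x. F (x, t) \<partial>Leb \<partial>Leb)"
    by (rule nn_integral_snd[symmetric]) measurable
  also have "\<dots> = (\<integral>\<^sup>+ t. \<integral>\<^sup>+ d. F (d + t, t) \<partial>Leb \<partial>Leb)"
    by (intro nn_integral_cong nn_integral_Leb_transl[symmetric]) measurable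
  also have "\<dots> = (\<integral>\<^sup>+ d. \<integral>\<^sup>+ t. F (d + t, t) \<partial>Leb \<partial>Leb)"
    by (rule Fubini') measurable
  finally show ?thesis by (simp add: add.commute)
qed

lemma nn_integral_pair_measure_weighted:
  assumes [measurable]: "F \<in> borel_measurable (borel \<Otimes>\<^sub>M borel)"
  shows "(\<integral>\<^sup>+ z. F z \<partial>pair_measure_weighted) = (\<integral>\<^sup>+ d. weight d * (\<integral>\<^sup>+ t. F (t + d, t) \<partial>Leb) \<partial>Leb)"
proof -
  have "(\<integral>\<^sup>+ z. F z \<partial>pair_measure_weighted) = (\<integral>\<^sup>+ z. weight (fst z - snd z) * F z \<partial>(Leb \<Otimes>\<^sub>M Leb))"
    unfolding pair_measure_weighted_def by (rule nn_integral_density) measurable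
  also have "\<dots> = (\<integral>\<^sup>+ d. \<integral>\<^sup>+ t. weight d * F (t + d, t) \<partial>Leb \<partial>Leb)"
    by (subst nn_integral_Leb_pair) simp_all
  also have "\<dots> = (\<integral>\<^sup>+ d. weight d * (\<integral>\<^sup>+ t. F (t + d, t) \<partial>Leb) \<partial>Leb)"
    by (intro nn_integral_cong nn_integral_cmult) measurable
  finally show ?thesis .
qed

sublocale pmw: finite_measure pair_measure_weighted
proof
  have "emeasure pair_measure_weighted (space pair_measure_weighted) = (\<integral>\<^sup>+ z. 1 \<partial>pair_measure_weighted)"
    by simp
  also have "\<dots> = (\<integral>\<^sup>+ d. weight d \<partial>Leb)"
    using Leb.emeasure_space_1 by (subst nn_integral_pair_measure_weighted) simp_all
  also have "\<dots> < \<infinity>" using finite_Z by (simp add: weight_def)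
  finally show "emeasure pair_measure_weighted (space pair_measure_weighted) \<noteq> \<infinity>" by simp
qed

lemma measurable_step [measurable]: "step A v \<in> borel_measurable borel"
  unfolding step_def[abs_def] by measurable

definition pair_step :: "circle \<Rightarrow> circle \<times> circle \<Rightarrow> circle \<times> circle"
  where "pair_step u z = (rand_step A v u (fst z), rand_step A v u (snd z))"

lemma pair_step_eq: "pair_step u z = (step A v (fst z) + u, step A v (snd z) + u)"
  by (simp add: pair_step_def rand_step_def transl_def)

text \<open>A uniform common translation forgets the position of a pair and keeps only its
  difference.\<close>

lemma nn_integral_diagonal:
  assumes [measurable]: "G \<in> borel_measurable (borel \<Otimes>\<^sub>M borel)"
  shows "(\<integral>\<^sup>+ u. G (p + u, q + u) \<partial>Leb) = (\<integral>\<^sup>+ t. G (t + (p - q), t) \<partial>Leb)"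
proof -
  have "(\<integral>\<^sup>+ u. G (u + q + (p - q), u + q) \<partial>Leb) = (\<integral>\<^sup>+ t. G (t + (p - q), t) \<partial>Leb)"
    by (rule nn_integral_Leb_transl[where f = "\<lambda>t. G (t + (p - q), t)"]) measurable
  then show ?thesis by (simp add: algebra_simps)
qed

text \<open>Integrating over the translation first leaves a function \<open>\<Gamma>\<close> of the
  new difference alone, so invariance for pairs reduces to invariance for the walk of
  differences.\<close>

lemma nn_integral_pair_step:
  assumes [measurable]: "G \<in> borel_measurable (borel \<Otimes>\<^sub>M borel)"
  shows "(\<integral>\<^sup>+ z. \<integral>\<^sup>+ u. G (pair_step u z) \<partial>Leb \<partial>pair_measure_weighted) = (\<integral>\<^sup>+ z. G z \<partial>pair_measure_weighted)"
proof -
  define \<Gamma> where "\<Gamma> d = (\<integral>\<^sup>+ t. G (t + d, t) \<partial>Leb)" for d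
  have [measurable]: "\<Gamma> \<in> borel_measurable borel"
    unfolding \<Gamma>_def by measurable
  have "(\<integral>\<^sup>+ z. \<integral>\<^sup>+ u. G (pair_step u z) \<partial>Leb \<partial>pair_measure_weighted) =
      (\<integral>\<^sup>+ z. \<Gamma> (step A v (fst z) - step A v (snd z)) \<partial>pair_measure_weighted)"
    unfolding pair_step_eq \<Gamma>_def by (intro nn_integral_cong nn_integral_diagonal) measurable
  also have "\<dots> = (\<integral>\<^sup>+ d. weight d * (\<integral>\<^sup>+ t. \<Gamma> (step A v (t + d) - step A v t) \<partial>Leb) \<partial>Leb)"
    by (subst nn_integral_pair_measure_weighted) simp_all
  also have "\<dots> = (\<integral>\<^sup>+ d. weight d * \<Gamma> d \<partial>Leb)"
    by (rule nn_integral_weight_step_diff) measurable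
  also have "\<dots> = (\<integral>\<^sup>+ z. G z \<partial>pair_measure_weighted)"
    unfolding \<Gamma>_def by (rule nn_integral_pair_measure_weighted[symmetric]) measurable
  finally show ?thesis .
qed

end

section \<open>The path space\<close>

lemma sets_Prob [measurable_cong]: "sets Prob = sets (\<Pi>\<^sub>M _\<in>UNIV. borel)"
  unfolding Prob_def by (intro sets_PiM_cong) simp_all

lemma space_Prob [simp]: "space Prob = UNIV"
  by (simp add: Prob_def space_PiM PiE_UNIV_domain)

lemma measurable_Prob_component:
  assumes "f \<in> measurable M Prob" shows "(\<lambda>x. f x n) \<in> borel_measurable M"
proof -
  have "(\<lambda>w. w n) \<in> borel_measurable Prob" by measurable
  from measurable_compose[OF assms this] show ?thesis .
qed

interpretation Prob: prob_space Prob
  unfolding Prob_def by (intro prob_space_PiM prob_space_Leb)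

lemma distr_Prob_case_nat: "distr (Leb \<Otimes>\<^sub>M Prob) Prob (\<lambda>(u, w). case_nat u w) = Prob"
proof -
  interpret sequence_space Leb by unfold_locales
  show ?thesis unfolding Prob_def by (rule PiM_iter)
qed

lemma measurable_case_nat_Prob: "(\<lambda>(u, w). case_nat u w) \<in> measurable (Leb \<Otimes>\<^sub>M Prob) Prob"
  by (simp add: case_prod_unfold) measurable

text \<open>The first parameter is independent of the remaining sequence, which has again the law
  \<open>Prob\<close>. The Markov property is used in this form and in its counterpart for real
  integrals.\<close>

lemma nn_integral_Prob:
  assumes [measurable]: "f \<in> borel_measurable Prob"
  shows "(\<integral>\<^sup>+ w. f w \<partial>Prob) = (\<integral>\<^sup>+ u. \<integral>\<^sup>+ w. f (case_nat u w) \<partial>Prob \<partial>Leb)"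
proof -
  note measurable_case_nat_Prob [measurable]
  have "(\<integral>\<^sup>+ w. f w \<partial>Prob) = (\<integral>\<^sup>+ w. f w \<partial>distr (Leb \<Otimes>\<^sub>M Prob) Prob (\<lambda>(u, w). case_nat u w))"
    by (simp add: distr_Prob_case_nat)
  also have "\<dots> = (\<integral>\<^sup>+ z. f ((\<lambda>(u, w). case_nat u w) z) \<partial>(Leb \<Otimes>\<^sub>M Prob))"
    by (rule nn_integral_distr) measurable
  also have "\<dots> = (\<integral>\<^sup>+ u. \<integral>\<^sup>+ w. f (case_nat u w) \<partial>Prob \<partial>Leb)"
    by (subst Prob.nn_integral_fst[symmetric]) (simp_all add: case_prod_unfold)
  finally show ?thesis .
qed

lemma integral_Prob:
  fixes f :: "(nat \<Rightarrow> circle) \<Rightarrow> real"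
  assumes "integrable Prob f"
  shows "(\<integral> w. f w \<partial>Prob) = (\<integral> u. \<integral> w. f (case_nat u w) \<partial>Prob \<partial>Leb)"
proof -
  interpret pair_sigma_finite Leb Prob ..
  note measurable_case_nat_Prob [measurable]
  have [measurable]: "f \<in> borel_measurable Prob" using assms by auto
  have "(\<integral> w. f w \<partial>Prob) = (\<integral> w. f w \<partial>distr (Leb \<Otimes>\<^sub>M Prob) Prob (\<lambda>(u, w). case_nat u w))"
    by (simp add: distr_Prob_case_nat)
  also have "\<dots> = (\<integral> z. f ((\<lambda>(u, w). case_nat u w) z) \<partial>(Leb \<Otimes>\<^sub>M Prob))"
    by (rule integral_distr) measurable
  also have "\<dots> = (\<integral> u. \<integral> w. f (case_nat u w) \<partial>Prob \<partial>Leb)"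
  proof -
    have "integrable (Leb \<Otimes>\<^sub>M Prob) (\<lambda>z. f ((\<lambda>(u, w). case_nat u w) z))"
      using assms by (intro integrable_distr[OF measurable_case_nat_Prob]) (simp add: distr_Prob_case_nat)
    from integral_fst'[OF this] show ?thesis by simp
  qed
  finally show ?thesis .
qed

context displacement_walk
begin

definition pair_iter :: "(nat \<Rightarrow> circle) \<Rightarrow> nat \<Rightarrow> circle \<times> circle \<Rightarrow> circle \<times> circle"
  where "pair_iter w n z = (rand_iter A v w n (fst z), rand_iter A v w n (snd z))"

lemma pair_iter_0 [simp]: "pair_iter w 0 z = z"
  by (simp add: pair_iter_def)

lemma pair_iter_Suc: "pair_iter w (Suc n) z = pair_step (w n) (pair_iter w n z)"
  by (simp add: pair_iter_def pair_step_def)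

text \<open>The recursion of \<open>pair_iter\<close> peels off the last step; this peels off the
  first one, as conditioning on the first parameter requires.\<close>

lemma pair_iter_case_nat: "pair_iter (case_nat u w) (Suc n) z = pair_iter w n (pair_step u z)"
  by (induction n) (simp_all add: pair_iter_Suc)

lemma measurable_pair_step [measurable (raw)]:
  assumes [measurable]: "f \<in> borel_measurable M" "g \<in> measurable M (borel \<Otimes>\<^sub>M borel)"
  shows "(\<lambda>x. pair_step (f x) (g x)) \<in> measurable M (borel \<Otimes>\<^sub>M borel)"
  unfolding pair_step_eq by measurable

lemma measurable_pair_iter [measurable (raw)]:
  assumes [measurable]: "f \<in> measurable M Prob" "g \<in> measurable M (borel \<Otimes>\<^sub>M borel)"
  shows "(\<lambda>x. pair_iter (f x) n (g x)) \<in> measurable M (borel \<Otimes>\<^sub>M borel)"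
proof (induction n)
  case (Suc n)
  show ?case unfolding pair_iter_Suc
    by (rule measurable_pair_step[OF measurable_Prob_component[OF assms(1)] Suc])
qed (simp add: assms)

section \<open>Orthogonality of increments along the walk\<close>

context
  fixes Y :: "circle \<times> circle \<Rightarrow> real" and C :: real
  assumes Y [measurable]: "Y \<in> borel_measurable (borel \<Otimes>\<^sub>M borel)"
    and Y_bound: "\<And>z. \<bar>Y z\<bar> \<le> C"
    and Y_mean: "\<And>p q. (\<integral>u. Y (p + u, q + u) \<partial>Leb) = 0"
begin

lemma measurable_Y_pair_iter [measurable]: "(\<lambda>w. Y (pair_iter w n z)) \<in> borel_measurable Prob"
proof (rule measurable_compose[OF measurable_pair_iter Y])
  show "(\<lambda>_. z) \<in> measurable Prob (borel \<Otimes>\<^sub>M borel)"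
    by (rule measurable_const) (simp add: space_pair_measure)
qed simp

lemma integrable_Y: "integrable Prob (\<lambda>w. Y (pair_iter w n z))"
  by (rule Prob.integrable_const_bound[of _ C]) (auto simp: Y_bound)

lemma integrable_Y_prod: "integrable Prob (\<lambda>w. Y (pair_iter w m z) * Y (pair_iter w n z))"
proof (rule Prob.integrable_const_bound[of _ "C * C"])
  have "C \<ge> 0" using Y_bound[of undefined] by linarith
  then show "AE w in Prob. norm (Y (pair_iter w m z) * Y (pair_iter w n z)) \<le> C * C"
    by (auto simp: abs_mult intro!: mult_mono Y_bound)
qed measurable

text \<open>The translation of the last step averages \<open>Y\<close> over all common translates of
  a pair, giving 0 by \<open>Y_mean\<close>. At time 0 no translation has acted yet, hence the index
  \<open>Suc n\<close>. Earlier parameters are peeled off by induction, for all starting pairs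
  simultaneously.\<close>

lemma integral_Y_eq_0: "(\<integral>w. Y (pair_iter w (Suc n) z) \<partial>Prob) = 0"
proof (induction n arbitrary: z)
  case 0
  show ?case
    by (subst integral_Prob[OF integrable_Y])
      (simp add: pair_iter_case_nat pair_step_eq Y_mean Prob.prob_space)
next
  case (Suc n)
  show ?case
    by (subst integral_Prob[OF integrable_Y]) (simp only: pair_iter_case_nat Suc, simp)
qed

text \<open>Conditioning on the first parameter lowers both times by one. Once the earlier time is 0
  its factor is the constant \<open>Y z\<close>, and the other factor has mean 0. In particular
  \<open>Y\<close> at time 0 need not be centred.\<close>

lemma integral_Y_prod_eq_0:
  assumes "m < n"
  shows "(\<integral>w. Y (pair_iter w m z) * Y (pair_iter w n z) \<partial>Prob) = 0"
  using assms
proof (induction m arbitrary: n z)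
  case 0
  then obtain k where "n = Suc k" using gr0_implies_Suc by blast
  then show ?case using integral_Y_eq_0[of k z] by simp
next
  case (Suc m)
  then obtain k where k: "n = Suc k" "m < k" by (metis Suc_lessE)
  show ?case unfolding k(1)
    by (subst integral_Prob[OF integrable_Y_prod]) (simp only: pair_iter_case_nat Suc.IH[OF k(2)], simp)
qed

lemma AE_average_Y_tendsto_0:
  "AE w in Prob. (\<lambda>n. (\<Sum>i<n. Y (pair_iter w i z)) / n) \<longlonglongrightarrow> 0"
  by (rule Prob.orthogonal_bounded_LLN[where C = C]) (auto simp: Y_bound integral_Y_prod_eq_0)

end

definition path_measure :: "((circle \<times> circle) \<times> (nat \<Rightarrow> circle)) measure"
  where "path_measure = pair_measure_weighted \<Otimes>\<^sub>M Prob"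

text \<open>The skew product over the shift: its iterates carry the pair along the walk, so time
  averages of the walk become Birkhoff sums of one measure-preserving map.\<close>

definition path_shift ::
    "(circle \<times> circle) \<times> (nat \<Rightarrow> circle) \<Rightarrow> (circle \<times> circle) \<times> (nat \<Rightarrow> circle)"
  where "path_shift = (\<lambda>(z, w). (pair_step (w 0) z, \<lambda>n. w (Suc n)))"

lemma funpow_path_shift: "(path_shift ^^ n) (z, w) = (pair_iter w n z, \<lambda>i. w (i + n))"
  by (induction n) (simp_all add: path_shift_def pair_iter_Suc)

lemma finite_path_measure: "finite_measure path_measure"
  unfolding path_measure_def
  by (intro finite_measure_pair_measure pmw.finite_measure_axioms Prob.finite_measure_axioms)

lemma measurable_path_shift [measurable]: "path_shift \<in> measurable path_measure path_measure"
proof -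
  have "(\<lambda>x. (\<lambda>n. snd x (Suc n))) \<in> measurable path_measure (\<Pi>\<^sub>M _\<in>UNIV. borel)"
    unfolding path_measure_def by (rule measurable_PiM_single') (auto simp: space_PiM)
  then have [measurable]: "(\<lambda>x. (\<lambda>n. snd x (Suc n))) \<in> measurable path_measure Prob" by measurable
  have [measurable]: "(\<lambda>x. snd x 0) \<in> borel_measurable (pair_measure_weighted \<Otimes>\<^sub>M Prob)"
    by (rule measurable_Prob_component) measurable
  have [measurable]: "(\<lambda>x. pair_step (snd x 0) (fst x)) \<in> measurable path_measure pair_measure_weighted"
    unfolding path_measure_def by measurable
  have "(\<lambda>x. (pair_step (snd x 0) (fst x), \<lambda>n. snd x (Suc n))) \<in>
      measurable path_measure (pair_measure_weighted \<Otimes>\<^sub>M Prob)"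
    by measurable
  then show ?thesis
    by (simp add: path_shift_def case_prod_unfold path_measure_def)
qed

text \<open>The parameter \<open>w 0\<close> moves the pair, and the shifted sequence is an
  independent sample of \<open>Prob\<close>; invariance therefore follows from
  \<open>nn_integral_pair_step\<close>.\<close>

lemma nn_integral_path_shift:
  assumes [measurable]: "F \<in> borel_measurable path_measure"
  shows "(\<integral>\<^sup>+ x. F (path_shift x) \<partial>path_measure) = (\<integral>\<^sup>+ x. F x \<partial>path_measure)"
proof -
  have F [measurable]: "F \<in> borel_measurable (pair_measure_weighted \<Otimes>\<^sub>M Prob)"
    using assms by (simp add: path_measure_def)
  have [measurable]: "path_shift \<in> measurable (pair_measure_weighted \<Otimes>\<^sub>M Prob) (pair_measure_weighted \<Otimes>\<^sub>M Prob)"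
    using measurable_path_shift by (simp add: path_measure_def)
  define G where "G z = (\<integral>\<^sup>+ w. F (z, w) \<partial>Prob)" for z
  have [measurable]: "G \<in> borel_measurable pair_measure_weighted"
    unfolding G_def by measurable
  have "(\<integral>\<^sup>+ x. F (path_shift x) \<partial>path_measure) =
      (\<integral>\<^sup>+ z. \<integral>\<^sup>+ w. F (path_shift (z, w)) \<partial>Prob \<partial>pair_measure_weighted)"
    unfolding path_measure_def by (rule Prob.nn_integral_fst[symmetric]) measurable
  also have "\<dots> = (\<integral>\<^sup>+ z. \<integral>\<^sup>+ u. \<integral>\<^sup>+ w. F (path_shift (z, case_nat u w)) \<partial>Prob \<partial>Leb \<partial>pair_measure_weighted)"
  proof (intro nn_integral_cong nn_integral_Prob)
    fix z assume "z \<in> space pair_measure_weighted"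
    then show "(\<lambda>w. F (path_shift (z, w))) \<in> borel_measurable Prob" by measurable
  qed
  also have "\<dots> = (\<integral>\<^sup>+ z. \<integral>\<^sup>+ u. G (pair_step u z) \<partial>Leb \<partial>pair_measure_weighted)"
    by (simp add: path_shift_def G_def)
  also have "\<dots> = (\<integral>\<^sup>+ z. G z \<partial>pair_measure_weighted)"
    by (rule nn_integral_pair_step) measurable
  also have "\<dots> = (\<integral>\<^sup>+ x. F x \<partial>path_measure)"
    unfolding G_def path_measure_def by (rule Prob.nn_integral_fst) measurable
  finally show ?thesis .
qed

lemma distr_path_shift: "distr path_measure path_measure path_shift = path_measure"
proof (rule measure_eqI)
  fix B assume "B \<in> sets (distr path_measure path_measure path_shift)"
  then have [measurable]: "B \<in> sets path_measure" by simp
  have "emeasure (distr path_measure path_measure path_shift) B =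
      (\<integral>\<^sup>+ x. indicator B x \<partial>distr path_measure path_measure path_shift)"
    by simp
  also have "\<dots> = (\<integral>\<^sup>+ x. indicator B (path_shift x) \<partial>path_measure)"
    by (rule nn_integral_distr) measurable
  also have "\<dots> = (\<integral>\<^sup>+ x. indicator B x \<partial>path_measure)"
    by (rule nn_integral_path_shift) measurable
  finally show "emeasure (distr path_measure path_measure path_shift) B = emeasure path_measure B"
    by simp
qed simp

end

section \<open>Weak convergence of the empirical measures\<close>

lemma empirical_eq_distr:
  fixes p :: "nat \<Rightarrow> 'a :: topological_space"
  assumes "N > 0"
  shows "empirical p N = distr (uniform_count_measure {1..N}) borel p"
proof (rule measure_eqI)
  fix B assume "B \<in> sets (empirical p N)"
  then have B: "B \<in> sets borel" by simp
  have "emeasure (distr (uniform_count_measure {1..N}) borel p) B =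
      ennreal (real (card (p -` B \<inter> {1..N})) / N)"
    using B by (subst emeasure_distr)
      (auto simp: emeasure_uniform_count_measure space_uniform_count_measure measurable_def
        sets_uniform_count_measure)
  also have "\<dots> = 1 / of_nat N * of_nat (card (p -` B \<inter> {1..N}))"
    using assms
    by (simp add: ennreal_of_nat_eq_real_of_nat divide_ennreal flip: ennreal_mult ennreal_1)
  also have "of_nat (card (p -` B \<inter> {1..N})) = (\<Sum>n=1..N. indicator B (p n) :: ennreal)"
    by (simp add: indicator_def sum.If_cases vimage_def Int_def conj_commute)
  finally show "emeasure (empirical p N) B = emeasure (distr (uniform_count_measure {1..N}) borel p) B"
    using B by (simp add: emeasure_empirical)
qed simp

lemma integral_empirical:
  fixes g :: "'a :: topological_space \<Rightarrow> real"
  assumes "N > 0" "g \<in> borel_measurable borel"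
  shows "(\<integral>x. g x \<partial>empirical p N) = (\<Sum>n=1..N. g (p n)) / N"
proof -
  have "p \<in> borel_measurable (uniform_count_measure {1..N})"
    by (auto simp: measurable_def sets_uniform_count_measure space_uniform_count_measure)
  from integral_distr[OF this assms(2)] assms(1) show ?thesis
    by (simp add: empirical_eq_distr integral_uniform_count_measure)
qed

text \<open>Birkhoff sums run over the times 0 to n - 1, empirical measures over 1 to N. The two
  sums differ by the bounded amount \<open>a n - a 0\<close>.\<close>

lemma shifted_average_tendsto:
  fixes a :: "nat \<Rightarrow> real"
  assumes bound: "\<And>n. \<bar>a n\<bar> \<le> C" and lim: "(\<lambda>n. (\<Sum>i<n. a i - m) / n) \<longlonglongrightarrow> 0"
  shows "(\<lambda>N. (\<Sum>n=1..N. a n) / N) \<longlonglongrightarrow> m"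
proof -
  have "(\<lambda>n. (a n - a 0) / n) \<longlonglongrightarrow> 0"
  proof (rule Lim_null_comparison)
    show "eventually (\<lambda>n. norm ((a n - a 0) / n) \<le> 2 * C / n) sequentially"
    proof (rule always_eventually, rule allI)
      fix n
      have "\<bar>a n - a 0\<bar> \<le> 2 * C" using bound[of n] bound[of 0] by linarith
      then show "norm ((a n - a 0) / n) \<le> 2 * C / n" by (simp add: divide_right_mono)
    qed
    show "(\<lambda>n. 2 * C / real n) \<longlonglongrightarrow> 0" by (rule lim_const_over_n)
  qed
  then have "(\<lambda>n. (\<Sum>i<n. a i - m) / n + (a n - a 0) / n + m) \<longlonglongrightarrow> 0 + 0 + m"
    by (intro tendsto_intros lim)
  moreover have "eventually (\<lambda>n. (\<Sum>i<n. a i - m) / n + (a n - a 0) / n + m = (\<Sum>i=1..n. a i) / n) sequentially"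
    using eventually_gt_at_top[of 0]
  proof eventually_elim
    case (elim n)
    have "(\<Sum>i<Suc n. a i) = a 0 + (\<Sum>i=1..n. a i)"
      by (simp only: lessThan_Suc_atMost atMost_atLeast0 sum.atLeast_Suc_atMost[OF le0] One_nat_def)
    then have "(\<Sum>i=1..n. a i) = (\<Sum>i<n. a i) + a n - a 0" by simp
    then have "(\<Sum>i=1..n. a i) / n = (\<Sum>i<n. a i) / n + (a n - a 0) / n"
      by (simp add: add_divide_distrib diff_divide_distrib)
    with elim show ?case by (simp add: sum_subtractf diff_divide_distrib)
  qed
  ultimately show ?thesis by (simp add: tendsto_cong)
qed

text \<open>Two coefficients per frequency keep the family of test functions countable. Real linear
  combinations give all trigonometric polynomials, and uniform approximation within
  \<open>e / 3\<close> gives all continuous functions.\<close>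

lemma converges_weakly_circleI:
  fixes p :: "nat \<Rightarrow> circle"
  assumes \<mu>: "prob_space \<mu>" "sets \<mu> = sets borel"
    and lim: "\<And>k c. c \<in> {1, \<i>} \<Longrightarrow>
      (\<lambda>N. (\<Sum>n=1..N. Re (c * circle_embed (p n) ^ k)) / N) \<longlonglongrightarrow> (\<integral>x. Re (c * circle_embed x ^ k) \<partial>\<mu>)"
  shows "converges_weakly (empirical p) \<mu>"
proof -
  interpret \<mu>: prob_space \<mu> by (rule \<mu>)
  note \<mu>(2) [measurable_cong]
  have int: "integrable \<mu> g" if g: "continuous_on UNIV g" for g :: "circle \<Rightarrow> real"
  proof -
    obtain C where "\<And>x. \<bar>g x\<bar> \<le> C" using bounded_continuous_circle[OF g] by metis
    moreover have "g \<in> borel_measurable borel"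
      by (rule borel_measurable_continuous_onI[OF g])
    ultimately show ?thesis by (intro \<mu>.integrable_const_bound[of _ C]) auto
  qed
  define avg where "avg g N = (\<Sum>n=1..N. g (p n)) / real N" for g :: "circle \<Rightarrow> real" and N
  have trig: "(\<lambda>N. avg q N) \<longlonglongrightarrow> (\<integral>x. q x \<partial>\<mu>)" if "q \<in> trig_polys" for q
    using that
  proof induction
    case (monom c k)
    \<comment> \<open>Here Re (\<open>\<i>\<close> z) is minus the imaginary part of z, so the two
      test coefficients recover an arbitrary \<open>c\<close> by real combination.\<close>
    have eq: "Re (c * z) = Re c * Re (1 * z) + Im c * Re (\<i> * z)" for z by simp
    have "(\<lambda>N. Re c * avg (\<lambda>x. Re (1 * circle_embed x ^ k)) N + Im c * avg (\<lambda>x. Re (\<i> * circle_embed x ^ k)) N)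
        \<longlonglongrightarrow> Re c * (\<integral>x. Re (1 * circle_embed x ^ k) \<partial>\<mu>) + Im c * (\<integral>x. Re (\<i> * circle_embed x ^ k) \<partial>\<mu>)"
      unfolding avg_def by (intro tendsto_intros lim) auto
    also have "(\<lambda>N. Re c * avg (\<lambda>x. Re (1 * circle_embed x ^ k)) N + Im c * avg (\<lambda>x. Re (\<i> * circle_embed x ^ k)) N)
        = (\<lambda>N. avg (\<lambda>x. Re (c * circle_embed x ^ k)) N)"
      unfolding avg_def eq[of "circle_embed _ ^ k"] by (simp only: sum.distrib add_divide_distrib sum_distrib_left times_divide_eq_right)
    also have "Re c * (\<integral>x. Re (1 * circle_embed x ^ k) \<partial>\<mu>) + Im c * (\<integral>x. Re (\<i> * circle_embed x ^ k) \<partial>\<mu>) =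
        (\<integral>x. Re c * Re (1 * circle_embed x ^ k) + Im c * Re (\<i> * circle_embed x ^ k) \<partial>\<mu>)"
      using int[OF continuous_on_trig_polys[OF trig_polys.monom[of 1 k]]]
        int[OF continuous_on_trig_polys[OF trig_polys.monom[of \<i> k]]]
      by simp
    also have "\<dots> = (\<integral>x. Re (c * circle_embed x ^ k) \<partial>\<mu>)"
      unfolding eq[of "circle_embed _ ^ k"] ..
    finally show ?case .
  next
    case (add f g)
    have "(\<lambda>N. avg f N + avg g N) \<longlonglongrightarrow> (\<integral>x. f x \<partial>\<mu>) + (\<integral>x. g x \<partial>\<mu>)"
      by (intro tendsto_intros add.IH)
    also have "(\<lambda>N. avg f N + avg g N) = avg (\<lambda>x. f x + g x)"
      by (simp add: avg_def sum.distrib add_divide_distrib fun_eq_iff)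
    also have "(\<integral>x. f x \<partial>\<mu>) + (\<integral>x. g x \<partial>\<mu>) = (\<integral>x. f x + g x \<partial>\<mu>)"
      using add.hyps by (intro Bochner_Integration.integral_add[symmetric] int continuous_on_trig_polys)
    finally show ?case .
  qed
  have avg_lim: "avg g \<longlonglongrightarrow> (\<integral>x. g x \<partial>\<mu>)" if g: "continuous_on UNIV g" for g
  proof (rule tendstoI)
    fix e :: real assume "e > 0"
    then obtain q where q: "q \<in> trig_polys" "\<And>x. \<bar>g x - q x\<bar> < e / 3"
      using trig_polys_uniformly_dense[OF g, of "e / 3"] by auto
    note int_q = int[OF continuous_on_trig_polys[OF q(1)]]
    have "\<bar>(\<integral>x. g x \<partial>\<mu>) - (\<integral>x. q x \<partial>\<mu>)\<bar> \<le> e / 3"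
    proof -
      have "(\<integral>x. g x \<partial>\<mu>) - (\<integral>x. q x \<partial>\<mu>) = (\<integral>x. g x - q x \<partial>\<mu>)"
        by (rule Bochner_Integration.integral_diff[OF int[OF g] int_q, symmetric])
      also have "\<bar>\<dots>\<bar> \<le> (\<integral>x. \<bar>g x - q x\<bar> \<partial>\<mu>)" by (rule integral_abs_bound)
      also have "\<dots> \<le> (\<integral>x. e / 3 \<partial>\<mu>)"
        using int[OF g] int_q q(2) by (intro integral_mono) (auto intro: less_imp_le)
      finally show ?thesis using \<mu>.prob_space by simp
    qed
    moreover have "\<bar>avg g N - avg q N\<bar> \<le> e / 3" for N
    proof (cases "N = 0")
      case False
      have "\<bar>avg g N - avg q N\<bar> = \<bar>\<Sum>n=1..N. g (p n) - q (p n)\<bar> / N"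
        by (simp add: avg_def sum_subtractf flip: diff_divide_distrib)
      also have "\<dots> \<le> (\<Sum>n=1..N. \<bar>g (p n) - q (p n)\<bar>) / N"
        by (rule divide_right_mono[OF sum_abs]) simp
      also have "\<dots> \<le> (\<Sum>n=1..N. e / 3) / N"
        by (rule divide_right_mono[OF sum_mono[OF less_imp_le[OF q(2)]]]) simp
      also have "\<dots> = e / 3" using False by simp
      finally show ?thesis .
    qed (use \<open>e > 0\<close> in \<open>simp add: avg_def\<close>)
    moreover have "eventually (\<lambda>N. dist (avg q N) (\<integral>x. q x \<partial>\<mu>) < e / 3) sequentially"
      using \<open>e > 0\<close> by (intro tendstoD[OF trig[OF q(1)]]) simp
    ultimately show "eventually (\<lambda>N. dist (avg g N) (\<integral>x. g x \<partial>\<mu>) < e) sequentially"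
    proof (elim eventually_mono)
      fix N
      assume a: "\<bar>(\<integral>x. g x \<partial>\<mu>) - (\<integral>x. q x \<partial>\<mu>)\<bar> \<le> e / 3"
        "\<And>N. \<bar>avg g N - avg q N\<bar> \<le> e / 3" "dist (avg q N) (\<integral>x. q x \<partial>\<mu>) < e / 3"
      show "dist (avg g N) (\<integral>x. g x \<partial>\<mu>) < e"
        using a(1,3) a(2)[of N] unfolding dist_real_def by linarith
    qed
  qed
  have avg_eq: "eventually (\<lambda>N. integral\<^sup>L (empirical p N) g = avg g N) sequentially"
    if "continuous_on UNIV g" for g
    using eventually_gt_at_top[of "0::nat"]
  proof eventually_elim
    case (elim N)
    show ?case
      unfolding avg_def by (rule integral_empirical[OF elim borel_measurable_continuous_onI[OF that]])
  qed
  show ?thesis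
    unfolding converges_weakly_def
    by (intro allI impI) (simp add: tendsto_cong[OF avg_eq] avg_lim)
qed

section \<open>Ergodic averages of continuous observables of the difference\<close>

context displacement_walk
begin

abbreviation pdiff :: "circle \<times> circle \<Rightarrow> circle" where "pdiff z \<equiv> fst z - snd z"

text \<open>The summand is \<open>h - P h\<close> at the current difference. Its Birkhoff sum is a
  sum of centred increments plus the telescoping term from \<open>h\<close>, which stays bounded and
  disappears on division by \<open>n\<close>.\<close>

lemma AE_coboundary_average_tendsto_0:
  assumes h: "h \<in> trig_polys"
  shows "AE x in path_measure. (\<lambda>n. birkhoff_sum path_shift (\<lambda>x. displacement A (pdiff (fst x)) *
    (2 * h (pdiff (fst x)) - h (pdiff (fst x) + v) - h (pdiff (fst x) - v)) / 2) n x / n) \<longlonglongrightarrow> 0"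
proof -
  note [measurable] = measurable_trig_polys[OF h]
  obtain C where C: "\<And>x. \<bar>h x\<bar> \<le> C"
    using bounded_continuous_circle[OF continuous_on_trig_polys[OF h]] by metis
  define c where "c d = displacement A d * (2 * h d - h (d + v) - h (d - v)) / 2" for d
  have [measurable]: "c \<in> borel_measurable borel" unfolding c_def by measurable
  have c_bound: "\<bar>c d\<bar> \<le> 2 * C" for d
  proof -
    have "\<bar>2 * h d - h (d + v) - h (d - v)\<bar> \<le> 4 * C"
      using C[of d] C[of "d + v"] C[of "d - v"] by linarith
    then have "\<bar>displacement A d\<bar> * \<bar>2 * h d - h (d + v) - h (d - v)\<bar> \<le> 1 * (4 * C)"
      using displacement_nonneg[of d] displacement_le_1[of d] by (intro mult_mono) auto
    then show ?thesis by (simp add: c_def abs_mult)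
  qed
  \<comment> \<open>The increment of \<open>h\<close> minus its conditional mean, with
    \<open>h - c\<close> in the role of \<open>P h\<close>. The translation of the coming step is
    absent since it cancels in the difference; the randomness deciding the jump is the translation
    of the previous step.\<close>
  define Y where "Y z = h (step A v (fst z) - step A v (snd z)) - (h (pdiff z) - c (pdiff z))" for z
  have Y: "Y \<in> borel_measurable (borel \<Otimes>\<^sub>M borel)" unfolding Y_def by measurable
  have Y_bound: "\<bar>Y z\<bar> \<le> 4 * C" for z
    using C[of "step A v (fst z) - step A v (snd z)"] C[of "pdiff z"] c_bound[of "pdiff z"]
    unfolding Y_def by linarith
  have Y_mean: "(\<integral>u. Y (p + u, q + u) \<partial>Leb) = 0" for p q
  proof -
    have [measurable]: "(\<lambda>u. h (step A v (p + u) - step A v (q + u))) \<in> borel_measurable Leb"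
      by measurable
    have "integrable Leb (\<lambda>u. h (step A v (p + u) - step A v (q + u)))"
      by (rule Leb.integrable_const_bound[of _ C]) (auto simp: C)
    then have "(\<integral>u. Y (p + u, q + u) \<partial>Leb) =
        (\<integral>u. h (step A v (p + u) - step A v (q + u)) \<partial>Leb) - (h (p - q) - c (p - q))"
      using Leb.prob_space by (simp add: Y_def)
    also have "(\<integral>u. h (step A v (p + u) - step A v (q + u)) \<partial>Leb) =
        (\<integral>u. h (step A v (u + q + (p - q)) - step A v (u + q)) \<partial>Leb)"
      by (simp add: algebra_simps)
    also have "\<dots> = (\<integral>t. h (step A v (t + (p - q)) - step A v t) \<partial>Leb)"
      by (rule integral_Leb_transl[where f = "\<lambda>t. h (step A v (t + (p - q)) - step A v t)"]) measurable
    also have "\<dots> = h (p - q) - c (p - q)" unfolding c_def by (rule integral_step_diff)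
    finally show ?thesis by simp
  qed
  have sum: "birkhoff_sum path_shift (\<lambda>x. c (pdiff (fst x))) n (z, w) =
      (\<Sum>i<n. Y (pair_iter w i z)) + (h (pdiff z) - h (pdiff (pair_iter w n z)))" for n z w
  proof -
    have "birkhoff_sum path_shift (\<lambda>x. c (pdiff (fst x))) n (z, w) =
        (\<Sum>i<n. Y (pair_iter w i z) + (h (pdiff (pair_iter w i z)) - h (pdiff (pair_iter w (Suc i) z))))"
      unfolding birkhoff_sum_def funpow_path_shift
      by (intro sum.cong) (simp_all add: Y_def pair_iter_Suc pair_step_eq)
    also have "\<dots> = (\<Sum>i<n. Y (pair_iter w i z)) + (\<Sum>i<n. h (pdiff (pair_iter w i z)) - h (pdiff (pair_iter w (Suc i) z)))"
      by (rule sum.distrib)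
    also have "(\<Sum>i<n. h (pdiff (pair_iter w i z)) - h (pdiff (pair_iter w (Suc i) z))) =
        h (pdiff z) - h (pdiff (pair_iter w n z))"
      by (subst sum_lessThan_telescope') simp
    finally show ?thesis .
  qed
  have AE: "AE w in Prob. (\<lambda>n. birkhoff_sum path_shift (\<lambda>x. c (pdiff (fst x))) n (z, w) / n) \<longlonglongrightarrow> 0" for z
    using AE_average_Y_tendsto_0[OF Y Y_bound Y_mean, of z]
  proof eventually_elim
    case (elim w)
    have "(\<lambda>n. (h (pdiff z) - h (pdiff (pair_iter w n z))) / n) \<longlonglongrightarrow> 0"
    proof (rule Lim_null_comparison)
      show "eventually (\<lambda>n. norm ((h (pdiff z) - h (pdiff (pair_iter w n z))) / n) \<le> 2 * C / n) sequentially"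
      proof (rule always_eventually, rule allI)
        fix n
        have "\<bar>h (pdiff z) - h (pdiff (pair_iter w n z))\<bar> \<le> 2 * C"
          using C[of "pdiff z"] C[of "pdiff (pair_iter w n z)"] by linarith
        then show "norm ((h (pdiff z) - h (pdiff (pair_iter w n z))) / n) \<le> 2 * C / n"
          by (simp add: divide_right_mono)
      qed
      show "(\<lambda>n. 2 * C / real n) \<longlonglongrightarrow> 0" by (rule lim_const_over_n)
    qed
    with elim show ?case unfolding sum add_divide_distrib by (rule tendsto_add_zero)
  qed
  interpret pair_sigma_finite pair_measure_weighted Prob ..
  have [measurable]: "birkhoff_sum path_shift (\<lambda>x. c (pdiff (fst x))) n \<in> borel_measurable path_measure" for n
  proof (rule measurable_birkhoff_sum)
    show "(\<lambda>x. c (pdiff (fst x))) \<in> borel_measurable path_measure"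
      unfolding path_measure_def by measurable
  qed measurable
  have "AE x in path_measure. (\<lambda>n. birkhoff_sum path_shift (\<lambda>x. c (pdiff (fst x))) n x / n) \<longlonglongrightarrow> 0"
    unfolding path_measure_def
  proof (rule AE_pair_measure)
    show "{x \<in> space (pair_measure_weighted \<Otimes>\<^sub>M Prob).
        (\<lambda>n. birkhoff_sum path_shift (\<lambda>x. c (pdiff (fst x))) n x / n) \<longlonglongrightarrow> 0} \<in> sets (pair_measure_weighted \<Otimes>\<^sub>M Prob)"
      unfolding path_measure_def[symmetric] by measurable
  qed (use AE in simp)
  then show ?thesis unfolding c_def .
qed

text \<open>The real-valued counterpart of \<open>weight\<close>. Where the displacement vanishes,
  \<open>recip\<close> is 0 and \<open>weight\<close> is infinite; these points form a null
  set.\<close>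

definition recip :: "circle \<Rightarrow> real" where "recip d = 1 / displacement A d"

lemma measurable_recip [measurable]: "recip \<in> borel_measurable borel"
  unfolding recip_def by measurable

lemma recip_nonneg: "recip d \<ge> 0"
  by (simp add: recip_def displacement_nonneg)

lemma weight_eq_recip: "displacement A d > 0 \<Longrightarrow> weight d = ennreal (recip d)"
  by (simp add: weight_pos_eq recip_def)

lemma nn_integral_recip: "(\<integral>\<^sup>+ d. ennreal (recip d * x d) \<partial>Leb) = (\<integral>\<^sup>+ d. weight d * ennreal (x d) \<partial>Leb)"
proof (intro nn_integral_cong_AE)
  show "AE d in Leb. ennreal (recip d * x d) = weight d * ennreal (x d)"
    using AE_displacement_pos
  proof eventually_elim
    case (elim d)
    have "ennreal (recip d * x d) = ennreal (recip d) * ennreal (x d)"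
      by (intro ennreal_mult' recip_nonneg)
    with elim show ?case by (simp only: weight_eq_recip)
  qed
qed

lemma integrable_recip: "integrable Leb recip"
proof (rule integrableI_bounded)
  have "(\<integral>\<^sup>+ d. ennreal (norm (recip d)) \<partial>Leb) = (\<integral>\<^sup>+ d. weight d \<partial>Leb)"
    using nn_integral_recip[of "\<lambda>_. 1"] by (simp add: recip_nonneg)
  then show "(\<integral>\<^sup>+ d. ennreal (norm (recip d)) \<partial>Leb) < \<infinity>"
    using finite_Z by (simp add: weight_def)
qed measurable

lemma Z_const_eq: "Z_const A = ennreal (\<integral>d. recip d \<partial>Leb)"
proof -
  have "Z_const A = (\<integral>\<^sup>+ d. ennreal (recip d) \<partial>Leb)"
    using nn_integral_recip[of "\<lambda>_. 1"] by (simp add: Z_const_def weight_def)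
  also have "\<dots> = ennreal (\<integral>d. recip d \<partial>Leb)"
    using integrable_recip by (intro nn_integral_eq_integral) (auto simp: recip_nonneg)
  finally show ?thesis .
qed

text \<open>The displacement is at most 1. This keeps the normalizing constant away from 0.\<close>

lemma integral_recip_ge_1: "(\<integral>d. recip d \<partial>Leb) \<ge> 1"
proof -
  have "(\<integral>d. 1 \<partial>Leb) \<le> (\<integral>d. recip d \<partial>Leb)"
  proof (intro integral_mono_AE integrable_recip)
    show "AE d in Leb. 1 \<le> recip d"
      using AE_displacement_pos by eventually_elim (simp add: recip_def displacement_le_1)
  qed simp
  then show ?thesis using Leb.prob_space by simp
qed

lemma mu_bar_eq: "mu_bar A = density Leb (\<lambda>d. ennreal (recip d / (\<integral>d. recip d \<partial>Leb)))"
  unfolding mu_bar_def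
proof (rule density_cong)
  show "AE d in Leb. 1 / Z_const A * (1 / ennreal (displacement A d)) = ennreal (recip d / (\<integral>d. recip d \<partial>Leb))"
    using AE_displacement_pos
  proof eventually_elim
    case (elim d)
    have "1 / Z_const A = ennreal (1 / (\<integral>d. recip d \<partial>Leb))"
      using integral_recip_ge_1 by (simp add: Z_const_eq divide_ennreal flip: ennreal_1)
    moreover have "1 / ennreal (displacement A d) = ennreal (recip d)"
      using weight_eq_recip[OF elim] by (simp add: weight_def)
    moreover have "ennreal (1 / (\<integral>d. recip d \<partial>Leb)) * ennreal (recip d) =
        ennreal (1 / (\<integral>d. recip d \<partial>Leb) * recip d)"
      using integral_recip_ge_1 by (intro ennreal_mult'[symmetric]) simp
    ultimately show ?case by (simp add: mult.commute)
  qed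
qed measurable

lemma prob_space_mu_bar: "prob_space (mu_bar A)"
proof
  define I where "I = (\<integral>d. recip d \<partial>Leb)"
  have I: "I \<ge> 1" using integral_recip_ge_1 by (simp add: I_def)
  have "emeasure (mu_bar A) (space (mu_bar A)) = (\<integral>\<^sup>+ d. ennreal (recip d / I) \<partial>Leb)"
    by (simp add: mu_bar_eq emeasure_density I_def)
  also have "\<dots> = ennreal (\<integral>d. recip d / I \<partial>Leb)"
    using integrable_recip I by (intro nn_integral_eq_integral) (auto simp: recip_nonneg)
  also have "(\<integral>d. recip d / I \<partial>Leb) = 1" using I by (simp add: I_def)
  finally show "emeasure (mu_bar A) (space (mu_bar A)) = 1" by simp
qed

lemma sets_mu_bar: "sets (mu_bar A) = sets borel"
  by (simp add: mu_bar_def)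

text \<open>This product form says that \<open>g\<close> minus its \<open>mu_bar A\<close>-mean
  integrates to 0 against \<open>recip\<close>, which is the solvability condition for the
  approximation by second differences.\<close>

lemma integral_mu_bar:
  assumes [measurable]: "g \<in> borel_measurable borel"
  shows "(\<integral>d. g d \<partial>mu_bar A) * (\<integral>d. recip d \<partial>Leb) = (\<integral>d. recip d * g d \<partial>Leb)"
proof -
  define I where "I = (\<integral>d. recip d \<partial>Leb)"
  have I: "I \<ge> 1" using integral_recip_ge_1 by (simp add: I_def)
  have "(\<integral>d. g d \<partial>mu_bar A) = (\<integral>d. recip d / I * g d \<partial>Leb)"
    unfolding mu_bar_eq I_def[symmetric]
    using I by (subst integral_density) (auto simp: recip_nonneg)
  also have "\<dots> = (\<integral>d. recip d * g d \<partial>Leb) / I" by simp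
  finally show ?thesis using I by (simp add: I_def[symmetric])
qed

lemma AE_birkhoff_average_tendsto_0:
  assumes g: "continuous_on UNIV g"
  shows "AE x in path_measure. (\<lambda>n. birkhoff_sum path_shift
    (\<lambda>x. g (pdiff (fst x)) - (\<integral>d. g d \<partial>mu_bar A)) n x / n) \<longlonglongrightarrow> 0"
proof (rule birkhoff_average_tendsto_0)
  show "finite_measure path_measure" by (rule finite_path_measure)
  show "path_shift \<in> measurable path_measure path_measure" by measurable
  show "distr path_measure path_measure path_shift = path_measure" by (rule distr_path_shift)
  define m where "m = (\<integral>d. g d \<partial>mu_bar A)"
  have [measurable]: "g \<in> borel_measurable borel" by (rule borel_measurable_continuous_onI[OF g])
  show "(\<lambda>x. g (pdiff (fst x)) - (\<integral>d. g d \<partial>mu_bar A)) \<in> borel_measurable path_measure"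
    unfolding path_measure_def by measurable
  obtain C where C: "\<And>x. \<bar>g x\<bar> \<le> C" using bounded_continuous_circle[OF g] by metis
  have int_g: "integrable Leb (\<lambda>d. recip d * g d)"
  proof (rule Bochner_Integration.integrable_bound)
    show "integrable Leb (\<lambda>d. C * recip d)" by (intro integrable_mult_right integrable_recip)
    show "AE d in Leb. norm (recip d * g d) \<le> norm (C * recip d)"
    proof (rule AE_I2)
      fix d
      have "\<bar>g d\<bar> * \<bar>recip d\<bar> \<le> \<bar>C\<bar> * \<bar>recip d\<bar>"
        using C[of d] by (intro mult_right_mono) auto
      then show "norm (recip d * g d) \<le> norm (C * recip d)" by (simp add: abs_mult mult.commute)
    qed
  qed measurable
  \<comment> \<open>The centred observable divided by the displacement: integrable because
    \<open>g\<close> is bounded and \<open>recip\<close> integrable, and of mean zero by the choice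
    of \<open>m\<close>.\<close>
  define \<psi> where "\<psi> d = recip d * g d - m * recip d" for d
  have \<psi>: "integrable Leb \<psi>" unfolding \<psi>_def using int_g integrable_recip by simp
  have "(\<integral>d. \<psi> d \<partial>Leb) = (\<integral>d. recip d * g d \<partial>Leb) - m * (\<integral>d. recip d \<partial>Leb)"
    unfolding \<psi>_def using int_g integrable_recip by simp
  then have \<psi>0: "(\<integral>d. \<psi> d \<partial>Leb) = 0"
    using integral_mu_bar[of g] by (simp add: m_def)
  fix e :: real assume e: "e > 0"
  obtain h where h: "h \<in> trig_polys"
    and h_approx: "(\<integral>d. \<bar>2 * \<psi> d - (2 * h d - h (d + v) - h (d - v))\<bar> \<partial>Leb) < e"
    using mean_zero_approx_second_difference[OF minimal_v, of "\<lambda>d. 2 * \<psi> d" e] \<psi> \<psi>0 e by auto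
  note [measurable] = measurable_trig_polys[OF h]
  define q where "q d = 2 * h d - h (d + v) - h (d - v)" for d
  have [measurable]: "q \<in> borel_measurable borel" unfolding q_def by measurable
  \<comment> \<open>The error left after replacing \<open>2 * \<psi>\<close> by the second
    difference \<open>q\<close>. Almost everywhere
    \<open>recip d * R d = (2 * \<psi> d - q d) / 2\<close>, so the unbounded density disappears
    from its norm.\<close>
  define R where "R d = g d - m - displacement A d * q d / 2" for d
  have [measurable]: "R \<in> borel_measurable borel" unfolding R_def by measurable
  have int_h: "integrable Leb q"
    using trig_polys_integrable[OF h] integrable_Leb_transl[OF trig_polys_integrable[OF h], of v]
      integrable_Leb_transl[OF trig_polys_integrable[OF h], of "- v"]
    by (simp add: q_def[abs_def])
  have [measurable]: "\<psi> \<in> borel_measurable borel" using \<psi> by auto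
  have nn: "(\<integral>\<^sup>+ x. ennreal \<bar>R (pdiff (fst x))\<bar> \<partial>path_measure) = ennreal (\<integral>d. \<bar>2 * \<psi> d - q d\<bar> / 2 \<partial>Leb)"
  proof -
    have "(\<integral>\<^sup>+ x. ennreal \<bar>R (pdiff (fst x))\<bar> \<partial>path_measure) =
        (\<integral>\<^sup>+ z. \<integral>\<^sup>+ w. ennreal \<bar>R (pdiff z)\<bar> \<partial>Prob \<partial>pair_measure_weighted)"
      unfolding path_measure_def by (subst Prob.nn_integral_fst[symmetric]) simp_all
    also have "\<dots> = (\<integral>\<^sup>+ z. ennreal \<bar>R (pdiff z)\<bar> \<partial>pair_measure_weighted)"
      by (simp add: Prob.emeasure_space_1[simplified])
    also have "\<dots> = (\<integral>\<^sup>+ d. weight d * ennreal \<bar>R d\<bar> \<partial>Leb)"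
      using Leb.emeasure_space_1 by (subst nn_integral_pair_measure_weighted) simp_all
    also have "\<dots> = (\<integral>\<^sup>+ d. ennreal (\<bar>2 * \<psi> d - q d\<bar> / 2) \<partial>Leb)"
      unfolding nn_integral_recip[symmetric]
    proof (intro nn_integral_cong_AE)
      show "AE d in Leb. ennreal (recip d * \<bar>R d\<bar>) = ennreal (\<bar>2 * \<psi> d - q d\<bar> / 2)"
        using AE_displacement_pos
      proof eventually_elim
        case (elim d)
        have "recip d * \<bar>R d\<bar> = \<bar>recip d * R d\<bar>" by (simp add: abs_mult recip_nonneg)
        also have "recip d * R d = (2 * \<psi> d - q d) / 2"
          using elim by (simp add: R_def \<psi>_def recip_def field_simps)
        finally show ?case by simp
      qed
    qed
    also have "\<dots> = ennreal (\<integral>d. \<bar>2 * \<psi> d - q d\<bar> / 2 \<partial>Leb)"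
      using \<psi> int_h by (intro nn_integral_eq_integral) auto
    finally show ?thesis .
  qed
  have [measurable]: "(\<lambda>x. R (pdiff (fst x))) \<in> borel_measurable path_measure"
    unfolding path_measure_def by measurable
  have "integrable path_measure (\<lambda>x. R (pdiff (fst x)))"
    by (rule integrableI_bounded) (simp_all add: nn)
  moreover have "(\<integral>x. \<bar>R (pdiff (fst x))\<bar> \<partial>path_measure) < e"
  proof -
    have "(\<integral>x. \<bar>R (pdiff (fst x))\<bar> \<partial>path_measure) = (\<integral>d. \<bar>2 * \<psi> d - q d\<bar> / 2 \<partial>Leb)"
      by (subst integral_eq_nn_integral) (simp_all add: nn)
    also have "\<dots> \<le> (\<integral>d. \<bar>2 * \<psi> d - q d\<bar> \<partial>Leb)" by simp
    also have "\<dots> < e" using h_approx by (simp add: q_def)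
    finally show ?thesis .
  qed
  moreover have "g (pdiff (fst x)) - m = displacement A (pdiff (fst x)) * q (pdiff (fst x)) / 2 + R (pdiff (fst x))"
    for x :: "(circle \<times> circle) \<times> (nat \<Rightarrow> circle)" by (simp add: R_def)
  moreover have "AE x in path_measure. (\<lambda>n. birkhoff_sum path_shift
      (\<lambda>x. displacement A (pdiff (fst x)) * q (pdiff (fst x)) / 2) n x / n) \<longlonglongrightarrow> 0"
    unfolding q_def by (rule AE_coboundary_average_tendsto_0[OF h])
  ultimately show "\<exists>c r. (\<forall>x. g (pdiff (fst x)) - (\<integral>d. g d \<partial>mu_bar A) = c x + r x) \<and>
      integrable path_measure r \<and> (\<integral>x. \<bar>r x\<bar> \<partial>path_measure) < e \<and>
      (AE x in path_measure. (\<lambda>n. birkhoff_sum path_shift c n x / n) \<longlonglongrightarrow> 0)"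
    unfolding m_def[symmetric]
    by (intro exI[of _ "\<lambda>x. displacement A (pdiff (fst x)) * q (pdiff (fst x)) / 2"]
        exI[of _ "\<lambda>x. R (pdiff (fst x))"] conjI allI)
qed

text \<open>Countably many characters allow one common null set of pairs and parameter sequences;
  Fubini then separates the starting pair from the sequence.\<close>

lemma AE_converges_weakly:
  "AE z in Leb \<Otimes>\<^sub>M Leb. AE w in Prob.
    converges_weakly (\<lambda>N. empirical (\<lambda>n. rand_iter A v w n (fst z) - rand_iter A v w n (snd z)) N) (mu_bar A)"
proof -
  interpret pair_sigma_finite pair_measure_weighted Prob ..
  define ch where "ch c k x = Re (c * circle_embed x ^ k)" for c k x
  have ch: "continuous_on UNIV (ch c k)" for c k
    unfolding ch_def by (intro continuous_on_trig_polys trig_polys.monom)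
  have "AE x in path_measure. \<forall>c\<in>{1, \<i>}. \<forall>k. (\<lambda>n. birkhoff_sum path_shift
      (\<lambda>x. ch c k (pdiff (fst x)) - (\<integral>d. ch c k d \<partial>mu_bar A)) n x / n) \<longlonglongrightarrow> 0"
    by (intro AE_ball_countable[THEN iffD2] ballI AE_all_countable[THEN iffD2] allI
        AE_birkhoff_average_tendsto_0 ch) auto
  then have "AE x in path_measure.
      converges_weakly (empirical (\<lambda>n. pdiff (pair_iter (snd x) n (fst x)))) (mu_bar A)"
  proof eventually_elim
    case (elim x)
    show ?case
    proof (rule converges_weakly_circleI[OF prob_space_mu_bar sets_mu_bar])
      fix c :: complex and k assume c: "c \<in> {1, \<i>}"
      obtain C where C: "\<And>x. \<bar>ch c k x\<bar> \<le> C" using bounded_continuous_circle[OF ch[of c k]] by metis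
      have "birkhoff_sum path_shift (\<lambda>x. ch c k (pdiff (fst x)) - (\<integral>d. ch c k d \<partial>mu_bar A)) n x =
          (\<Sum>i<n. ch c k (pdiff (pair_iter (snd x) i (fst x))) - (\<integral>d. ch c k d \<partial>mu_bar A))" for n
        unfolding birkhoff_sum_def
        using funpow_path_shift[of _ "fst x" "snd x"] by simp
      moreover have "(\<lambda>n. birkhoff_sum path_shift (\<lambda>x. ch c k (pdiff (fst x)) - (\<integral>d. ch c k d \<partial>mu_bar A)) n x / n) \<longlonglongrightarrow> 0"
        using elim c by blast
      ultimately have "(\<lambda>n. (\<Sum>i<n. ch c k (pdiff (pair_iter (snd x) i (fst x))) - (\<integral>d. ch c k d \<partial>mu_bar A)) / n) \<longlonglongrightarrow> 0"
        by simp
      from shifted_average_tendsto[OF C this]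
      show "(\<lambda>N. (\<Sum>n=1..N. Re (c * circle_embed (pdiff (pair_iter (snd x) n (fst x))) ^ k)) / N)
          \<longlonglongrightarrow> (\<integral>x. Re (c * circle_embed x ^ k) \<partial>mu_bar A)"
        by (simp only: ch_def)
    qed
  qed
  from AE_pair[OF this[unfolded path_measure_def]]
  have "AE z in pair_measure_weighted. AE w in Prob.
      converges_weakly (empirical (\<lambda>n. pdiff (pair_iter w n z))) (mu_bar A)"
    by simp
  \<comment> \<open>The density of the weighted measure is positive everywhere, so its null sets are
    null for \<open>Leb \<Otimes>\<^sub>M Leb\<close>.\<close>
  then show ?thesis
    unfolding pair_measure_weighted_def
    by (subst (asm) AE_density) (simp_all add: weight_pos pair_iter_def)
qed

end

theorem theorem4:
  fixes A :: "circle set" and v :: circle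
  assumes "A \<in> sets borel"
    and "no_transl_symmetries A"
    and "(\<integral>\<^sup>+ \<epsilon>. 1 / ennreal (displacement A \<epsilon>) \<partial>Leb) < \<infinity>"
    and "minimal (transl v)"
  shows "prob_space (mu_bar A) \<and>
    (AE (x, y) in Leb \<Otimes>\<^sub>M Leb. AE w in Prob.
      converges_weakly (\<lambda>N. empirical (\<lambda>n. rand_iter A v w n x - rand_iter A v w n y) N) (mu_bar A))"
proof -
  interpret displacement_walk A v
    by unfold_locales (use assms in auto)
  show ?thesis
    using prob_space_mu_bar AE_converges_weakly by (simp add: case_prod_unfold)
qed

end
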